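(* Let $E$ be a non-trivial locally convex Hausdorff space over $\mathbb{K}$ and let $(T^{E}_{m},T^{\mathbb{K}}_{m})_{m\in M}$ be a consistent generator for $(\mathcal{FV},E)$. Then the map $S\colon \mathcal{FV}(\Omega)\varepsilon E\to\mathcal{FV}(\Omega,E)$, $S(u)(x):=u(\delta_{x})$, is well-defined and a topological isomorphism into, i.e. it is injective, continuous, and its inverse on its range is continuous.
   Context: $\mathbb{K}\in\{\mathbb{R},\mathbb{C}\}$. Let $\Omega$ be a non-empty set, $J,M$ non-empty index sets, $(\omega_m)_{m\in M}$ non-empty sets and $\mathcal{V}=(\nu_{j,m})_{j\in J,m\in M}$ functions $\nu_{j,m}\colon\omega_m\to[0,\infty)$ such that for all $m\in M$, $x\in\omega_m$ there is $j\in J$ with $\nu_{j,m}(x)>0$. For $Y\in\{\mathbb{K},E\}$, where $E$ has a directed fundamental system of seminorms $(p_\alpha)_{\alpha\in\mathfrak{A}}$ (for $Y=\mathbb{K}$ take only $|\cdot|$), let $\operatorname{AP}(\Omega,Y)\subset Y^\Omega$ be a linear subspace and for each $m\in M$ let $T^{Y}_m\colon \operatorname{dom}T^Y_m\to Y^{\omega_m}$ be a linear map on a linear subspace $\operatorname{dom}T^Y_m\subset Y^\Omega$. Put $\mathcal{FV}(\Omega,Y):=\{f\in \operatorname{AP}(\Omega,Y)\cap\bigcap_{m}\operatorname{dom}T^Y_m : |f|_{j,m,\alpha}<\infty\ \forall j,m,\alpha\}$ with $|f|_{j,m,\alpha}:=\sup_{x\in\omega_m}p_\alpha(T^Y_m(f)(x))\nu_{j,m}(x)$,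 carrying the locally convex topology of these seminorms; $\mathcal{FV}(\Omega):=\mathcal{FV}(\Omega,\mathbb{K})$, $T^{Y}_{m,x}(f):=T^Y_m(f)(x)$. $\mathcal{FV}(\Omega,Y)$ is a dom-space if it is Hausdorff, its system of seminorms is directed, and (when $Y=\mathbb{K}$) every point evaluation $\delta_x\colon f\mapsto f(x)$, $x\in\Omega$, lies in $\mathcal{FV}(\Omega)'$. A generator for $(\mathcal{FV},E)$ is the family $(T^E_m,T^{\mathbb{K}}_m)_{m\in M}$ where $\mathcal{FV}(\Omega)$ and $\mathcal{FV}(\Omega,E)$ are both dom-spaces built with the same $J,M,\omega_m,\nu_{j,m}$. The $\varepsilon$-product $\mathcal{FV}(\Omega)\varepsilon E$ is the space of continuous linear maps $\mathcal{FV}(\Omega)'_\kappa\to E$, where $\mathcal{FV}(\Omega)'_\kappa$ is the dual with the topology of uniform convergence on absolutely convex compact subsets of $\mathcal{FV}(\Omega)$, equipped with the topology of uniform convergence on equicontinuous subsets of $\mathcal{FV}(\Omega)'$. The generator is consistent if for all $u\in\mathcal{FV}(\Omega)\varepsilon E$, $m\in M$, $x\in\omega_m$: (i) $S(u)\in\operatorname{AP}(\Omega,E)$ where $S(u)(x):=u(\delta_x)$; (ii) $S(u)\in\operatorname{dom}T^E_m$ and $T^E_m(S(u))(x)=u(T^{\mathbb{K}}_{m,x})$ (with $T^{\mathbb{K}}_{m,x}$ restricted to $\mathcal{FV}(\Omega)$). *)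

theory Defs
  imports "HOL-Analysis.Analysis"
begin

text \<open>Scalars: a type 'k of class real_normed_field (every such field is R or C
  by the Gelfand-Mazur theorem); the absolute value is norm.
  Vector-valued functions carry pointwise operations; elements of function spaces
  are functions 'z => 'e, with scalar multiplication sc applied pointwise.\<close>

definition fun_subspace :: "('k::field \<Rightarrow> 'e::ab_group_add \<Rightarrow> 'e) \<Rightarrow> ('z \<Rightarrow> 'e) set \<Rightarrow> bool" where
  "fun_subspace sc X \<longleftrightarrow> (\<lambda>_. 0) \<in> X \<and>
     (\<forall>f\<in>X. \<forall>g\<in>X. \<forall>a b. (\<lambda>w. sc a (f w) + sc b (g w)) \<in> X)"

definition fun_lin_on :: "('k::field \<Rightarrow> 'e::ab_group_add \<Rightarrow> 'e) \<Rightarrow> ('z \<Rightarrow> 'e) set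
    \<Rightarrow> ('k \<Rightarrow> 'f::ab_group_add \<Rightarrow> 'f) \<Rightarrow> (('z \<Rightarrow> 'e) \<Rightarrow> 'f) \<Rightarrow> bool" where
  "fun_lin_on sc X sc' u \<longleftrightarrow>
     (\<forall>f\<in>X. \<forall>g\<in>X. \<forall>a b. u (\<lambda>w. sc a (f w) + sc b (g w)) = sc' a (u f) + sc' b (u g))"

definition is_seminorm :: "('k::real_normed_field \<Rightarrow> 'e::ab_group_add \<Rightarrow> 'e) \<Rightarrow> ('e \<Rightarrow> real) \<Rightarrow> bool" where
  "is_seminorm sc q \<longleftrightarrow> (\<forall>x. q x \<ge> 0) \<and> (\<forall>a x. q (sc a x) = norm a * q x) \<and>
     (\<forall>x y. q (x + y) \<le> q x + q y)"

definition lc_hausdorff :: "('k::real_normed_field \<Rightarrow> 'e::ab_group_add \<Rightarrow> 'e) \<Rightarrow> 'a set \<Rightarrow> ('a \<Rightarrow> 'e \<Rightarrow> real) \<Rightarrow> bool" where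
  "lc_hausdorff sc A p \<longleftrightarrow> Vector_Spaces.vector_space sc \<and> A \<noteq> {} \<and>
     (\<forall>\<alpha>\<in>A. is_seminorm sc (p \<alpha>)) \<and>
     (\<forall>\<alpha>\<in>A. \<forall>\<beta>\<in>A. \<exists>\<gamma>\<in>A. \<exists>C. \<forall>x. max (p \<alpha> x) (p \<beta> x) \<le> C * p \<gamma> x) \<and>
     (\<forall>x. (\<forall>\<alpha>\<in>A. p \<alpha> x = 0) \<longrightarrow> x = 0)"

definition sn_topology :: "('z \<Rightarrow> 'e::ab_group_add) set \<Rightarrow> 'i set \<Rightarrow> ('i \<Rightarrow> ('z \<Rightarrow> 'e) \<Rightarrow> real)
    \<Rightarrow> ('z \<Rightarrow> 'e) topology" where
  "sn_topology X I q = topology (\<lambda>U. U \<subseteq> X \<and> (\<forall>f\<in>U. \<exists>F \<epsilon>. finite F \<and> F \<subseteq> I \<and> \<epsilon> > 0 \<and>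
       {g\<in>X. \<forall>i\<in>F. q i (\<lambda>w. g w - f w) < \<epsilon>} \<subseteq> U))"

definition sn_cont :: "'v set \<Rightarrow> 'i set \<Rightarrow> ('i \<Rightarrow> 'v \<Rightarrow> real) \<Rightarrow> 'b set \<Rightarrow> ('b \<Rightarrow> 'y \<Rightarrow> real)
    \<Rightarrow> ('v \<Rightarrow> 'y) \<Rightarrow> bool" where
  "sn_cont X I q B r u \<longleftrightarrow> (\<forall>\<beta>\<in>B. \<exists>F C. finite F \<and> F \<subseteq> I \<and>
       (\<forall>x\<in>X. r \<beta> (u x) \<le> C * (\<Sum>i\<in>F. q i x)))"

text \<open>Topological dual of (X, (q i)_{i\<in>I}); functionals are normalised to be 0 outside X.\<close>
definition sn_dual :: "('w \<Rightarrow> 'k::real_normed_field) set \<Rightarrow> 'i set \<Rightarrow> ('i \<Rightarrow> ('w \<Rightarrow> 'k) \<Rightarrow> real)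
    \<Rightarrow> (('w \<Rightarrow> 'k) \<Rightarrow> 'k) set" where
  "sn_dual X I q = {y. fun_lin_on (*) X (*) y \<and> (\<forall>f. f \<notin> X \<longrightarrow> y f = 0) \<and>
      sn_cont X I q {()} (\<lambda>_. norm) y}"

definition abs_convex :: "('k::real_normed_field \<Rightarrow> 'e::ab_group_add \<Rightarrow> 'e) \<Rightarrow> ('z \<Rightarrow> 'e) set \<Rightarrow> bool" where
  "abs_convex sc K \<longleftrightarrow> (\<forall>f\<in>K. \<forall>g\<in>K. \<forall>a b. norm a + norm b \<le> 1 \<longrightarrow>
      (\<lambda>w. sc a (f w) + sc b (g w)) \<in> K)"

text \<open>Index set and seminorms of the topology kappa on the dual: uniform convergence on
  (non-empty) absolutely convex compact subsets of X.\<close>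
definition kappa_idx :: "('w \<Rightarrow> 'k::real_normed_field) set \<Rightarrow> 'i set \<Rightarrow> ('i \<Rightarrow> ('w \<Rightarrow> 'k) \<Rightarrow> real)
    \<Rightarrow> ('w \<Rightarrow> 'k) set set" where
  "kappa_idx X I q = {K. K \<noteq> {} \<and> K \<subseteq> X \<and> abs_convex (*) K \<and> compactin (sn_topology X I q) K}"

definition kappa_sn :: "('w \<Rightarrow> 'k::real_normed_field) set \<Rightarrow> (('w \<Rightarrow> 'k) \<Rightarrow> 'k) \<Rightarrow> real" where
  "kappa_sn K y = (SUP f\<in>K. norm (y f))"

text \<open>The epsilon-product X \<epsilon> E: continuous linear maps from the dual with topology kappa
  into E (normalised to be 0 outside the dual).\<close>
definition eps_product :: "('w \<Rightarrow> 'k::real_normed_field) set \<Rightarrow> 'i set \<Rightarrow> ('i \<Rightarrow> ('w \<Rightarrow> 'k) \<Rightarrow> real)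
    \<Rightarrow> ('k \<Rightarrow> 'e::ab_group_add \<Rightarrow> 'e) \<Rightarrow> 'a set \<Rightarrow> ('a \<Rightarrow> 'e \<Rightarrow> real)
    \<Rightarrow> ((('w \<Rightarrow> 'k) \<Rightarrow> 'k) \<Rightarrow> 'e) set" where
  "eps_product X I q sc A p = {u. fun_lin_on (*) (sn_dual X I q) sc u \<and>
      (\<forall>y. y \<notin> sn_dual X I q \<longrightarrow> u y = 0) \<and>
      sn_cont (sn_dual X I q) (kappa_idx X I q) kappa_sn A p u}"

definition equicont :: "('w \<Rightarrow> 'k::real_normed_field) set \<Rightarrow> 'i set \<Rightarrow> ('i \<Rightarrow> ('w \<Rightarrow> 'k) \<Rightarrow> real)
    \<Rightarrow> (('w \<Rightarrow> 'k) \<Rightarrow> 'k) set \<Rightarrow> bool" where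
  "equicont X I q H \<longleftrightarrow> H \<subseteq> sn_dual X I q \<and> (\<exists>F C. finite F \<and> F \<subseteq> I \<and>
      (\<forall>y\<in>H. \<forall>f\<in>X. norm (y f) \<le> C * (\<Sum>i\<in>F. q i f)))"

text \<open>Seminorms of the epsilon-product: uniform convergence on (non-empty) equicontinuous sets.\<close>
definition eps_idx :: "('w \<Rightarrow> 'k::real_normed_field) set \<Rightarrow> 'i set \<Rightarrow> ('i \<Rightarrow> ('w \<Rightarrow> 'k) \<Rightarrow> real)
    \<Rightarrow> 'a set \<Rightarrow> ((('w \<Rightarrow> 'k) \<Rightarrow> 'k) set \<times> 'a) set" where
  "eps_idx X I q A = {(H, \<alpha>). equicont X I q H \<and> H \<noteq> {} \<and> \<alpha> \<in> A}"

definition eps_sn :: "('a \<Rightarrow> 'e \<Rightarrow> real) \<Rightarrow> ((('w \<Rightarrow> 'k) \<Rightarrow> 'k) set \<times> 'a) \<Rightarrow> ((('w \<Rightarrow> 'k) \<Rightarrow> 'k) \<Rightarrow> 'e) \<Rightarrow> real" where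
  "eps_sn p Ha u = (SUP y\<in>fst Ha. p (snd Ha) (u y))"

definition point_eval :: "('w \<Rightarrow> 'k::zero) set \<Rightarrow> 'w \<Rightarrow> (('w \<Rightarrow> 'k) \<Rightarrow> 'k)" where
  "point_eval X x = (\<lambda>f. if f \<in> X then f x else 0)"

definition S_map :: "('w \<Rightarrow> 'k::zero) set \<Rightarrow> ((('w \<Rightarrow> 'k) \<Rightarrow> 'k) \<Rightarrow> 'e) \<Rightarrow> 'w \<Rightarrow> 'e" where
  "S_map X u = (\<lambda>x. u (point_eval X x))"

text \<open>The weighted spaces FV(Omega, Y): Omega is the type 'w, J the type 'j, M the type 'm,
  omega_m = om m, nu_{j,m} = nu j m.  For Y = K take A = {()} and p = (\<lambda>_. norm).\<close>
definition FV :: "'a set \<Rightarrow> ('a \<Rightarrow> 'e \<Rightarrow> real) \<Rightarrow> ('w \<Rightarrow> 'e) set \<Rightarrow> ('m \<Rightarrow> ('w \<Rightarrow> 'e) set)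
    \<Rightarrow> ('m \<Rightarrow> ('w \<Rightarrow> 'e) \<Rightarrow> 'x \<Rightarrow> 'e) \<Rightarrow> ('m \<Rightarrow> 'x set) \<Rightarrow> ('j \<Rightarrow> 'm \<Rightarrow> 'x \<Rightarrow> real) \<Rightarrow> ('w \<Rightarrow> 'e) set" where
  "FV A p AP domT T om nu = {f \<in> AP. (\<forall>m. f \<in> domT m) \<and>
      (\<forall>j m. \<forall>\<alpha>\<in>A. bdd_above ((\<lambda>x. p \<alpha> (T m f x) * nu j m x) ` om m))}"

definition FV_idx :: "'a set \<Rightarrow> ('j \<times> 'm \<times> 'a) set" where
  "FV_idx A = UNIV \<times> UNIV \<times> A"

definition FV_sn :: "('a \<Rightarrow> 'e \<Rightarrow> real) \<Rightarrow> ('m \<Rightarrow> ('w \<Rightarrow> 'e) \<Rightarrow> 'x \<Rightarrow> 'e) \<Rightarrow> ('m \<Rightarrow> 'x set)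
    \<Rightarrow> ('j \<Rightarrow> 'm \<Rightarrow> 'x \<Rightarrow> real) \<Rightarrow> ('j \<times> 'm \<times> 'a) \<Rightarrow> ('w \<Rightarrow> 'e) \<Rightarrow> real" where
  "FV_sn p T om nu i f = (case i of (j, m, \<alpha>) \<Rightarrow> (SUP x\<in>om m. p \<alpha> (T m f x) * nu j m x))"

definition weight_system :: "('m \<Rightarrow> 'x set) \<Rightarrow> ('j \<Rightarrow> 'm \<Rightarrow> 'x \<Rightarrow> real) \<Rightarrow> bool" where
  "weight_system om nu \<longleftrightarrow> (\<forall>m. om m \<noteq> {}) \<and> (\<forall>j m. \<forall>x\<in>om m. nu j m x \<ge> 0) \<and>
      (\<forall>m. \<forall>x\<in>om m. \<exists>j. nu j m x > 0)"

definition FV_data :: "('k::field \<Rightarrow> 'e::ab_group_add \<Rightarrow> 'e) \<Rightarrow> ('w \<Rightarrow> 'e) set \<Rightarrow> ('m \<Rightarrow> ('w \<Rightarrow> 'e) set)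
    \<Rightarrow> ('m \<Rightarrow> ('w \<Rightarrow> 'e) \<Rightarrow> 'x \<Rightarrow> 'e) \<Rightarrow> bool" where
  "FV_data sc AP domT T \<longleftrightarrow> fun_subspace sc AP \<and> (\<forall>m. fun_subspace sc (domT m)) \<and>
      (\<forall>m. \<forall>f\<in>domT m. \<forall>g\<in>domT m. \<forall>a b.
         T m (\<lambda>w. sc a (f w) + sc b (g w)) = (\<lambda>x. sc a (T m f x) + sc b (T m g x)))"

definition hausdorff_directed :: "('w \<Rightarrow> 'e::zero) set \<Rightarrow> 'i set \<Rightarrow> ('i \<Rightarrow> ('w \<Rightarrow> 'e) \<Rightarrow> real) \<Rightarrow> bool" where
  "hausdorff_directed X I q \<longleftrightarrow> (\<forall>f\<in>X. (\<forall>i\<in>I. q i f = 0) \<longrightarrow> f = (\<lambda>_. 0)) \<and>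
      (\<forall>i1\<in>I. \<forall>i2\<in>I. \<exists>i3\<in>I. \<exists>C. \<forall>f\<in>X. max (q i1 f) (q i2 f) \<le> C * q i3 f)"

definition generator :: "('k::real_normed_field \<Rightarrow> 'e::ab_group_add \<Rightarrow> 'e) \<Rightarrow> 'a set \<Rightarrow> ('a \<Rightarrow> 'e \<Rightarrow> real)
    \<Rightarrow> ('m \<Rightarrow> 'x set) \<Rightarrow> ('j \<Rightarrow> 'm \<Rightarrow> 'x \<Rightarrow> real)
    \<Rightarrow> ('w \<Rightarrow> 'k) set \<Rightarrow> ('m \<Rightarrow> ('w \<Rightarrow> 'k) set) \<Rightarrow> ('m \<Rightarrow> ('w \<Rightarrow> 'k) \<Rightarrow> 'x \<Rightarrow> 'k)
    \<Rightarrow> ('w \<Rightarrow> 'e) set \<Rightarrow> ('m \<Rightarrow> ('w \<Rightarrow> 'e) set) \<Rightarrow> ('m \<Rightarrow> ('w \<Rightarrow> 'e) \<Rightarrow> 'x \<Rightarrow> 'e) \<Rightarrow> bool" where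
  "generator sc A p om nu APK domK TK APE domE TE \<longleftrightarrow>
     FV_data (*) APK domK TK \<and> FV_data sc APE domE TE \<and>
     (let XK = FV {()} (\<lambda>_. norm) APK domK TK om nu;
          qK = FV_sn (\<lambda>_. norm) TK om nu;
          XE = FV A p APE domE TE om nu
      in hausdorff_directed XK (FV_idx {()}) qK \<and>
         (\<forall>x. point_eval XK x \<in> sn_dual XK (FV_idx {()}) qK) \<and>
         hausdorff_directed XE (FV_idx A) (FV_sn p TE om nu))"

definition consistent :: "('k::real_normed_field \<Rightarrow> 'e::ab_group_add \<Rightarrow> 'e) \<Rightarrow> 'a set \<Rightarrow> ('a \<Rightarrow> 'e \<Rightarrow> real)
    \<Rightarrow> ('m \<Rightarrow> 'x set) \<Rightarrow> ('j \<Rightarrow> 'm \<Rightarrow> 'x \<Rightarrow> real)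
    \<Rightarrow> ('w \<Rightarrow> 'k) set \<Rightarrow> ('m \<Rightarrow> ('w \<Rightarrow> 'k) set) \<Rightarrow> ('m \<Rightarrow> ('w \<Rightarrow> 'k) \<Rightarrow> 'x \<Rightarrow> 'k)
    \<Rightarrow> ('w \<Rightarrow> 'e) set \<Rightarrow> ('m \<Rightarrow> ('w \<Rightarrow> 'e) set) \<Rightarrow> ('m \<Rightarrow> ('w \<Rightarrow> 'e) \<Rightarrow> 'x \<Rightarrow> 'e) \<Rightarrow> bool" where
  "consistent sc A p om nu APK domK TK APE domE TE \<longleftrightarrow>
     (let XK = FV {()} (\<lambda>_. norm) APK domK TK om nu;
          qK = FV_sn (\<lambda>_. norm) TK om nu
      in \<forall>u\<in>eps_product XK (FV_idx {()}) qK sc A p. \<forall>m. \<forall>x\<in>om m.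
           S_map XK u \<in> APE \<and> S_map XK u \<in> domE m \<and>
           TE m (S_map XK u) x = u (\<lambda>f. if f \<in> XK then TK m f x else 0))"

end

theory Submission
  imports Defs
begin

text \<open>Everything reduces to the continuity of the inverse, which is a bipolar argument. An
  equicontinuous set consists of functionals y with |y f| \<open>\<le>\<close> C sup_x |T_x f| nu(x), so y lies in
  the kappa-closure of the convex hull of C D, where D is the set of all a nu(x) T_x with |a| = 1.
  Any u in the epsilon-product is kappa-continuous and u(nu(x) T_x) = nu(x) T_x(S(u)), so p(u(y))
  is at most C times the seminorm of S(u). Instead of Hahn-Banach and Mackey-Arens, the
  approximation of y by convex combinations of elements of D, uniformly on compact absolutely convex
  sets, comes from Ky Fan's minimax argument: by compactness only finitely many elements of D
  matter, and for these the separating weights are found by induction.\<close>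

section \<open>Ky Fan's alternative\<close>

text \<open>The usual bipolar argument separates y from the hull of the test functionals by a
  functional on the kappa-dual and then needs that functional to be given by an element of X. Here
  the element is explicit: it is a sum of points, one from each compact set entering the bound on u,
  and at this element the domination of y by the test functionals can be evaluated directly. Fan's
  alternative compares real numbers, while the scalars are only assumed to form a real normed field;
  this is why a real part has to be recovered from the norm. Compactness also yields that S is well
  defined: p composed with u is controlled by finitely many compact sets, each seminorm of the
  scalar space is bounded on each of them, and weighted evaluations are dominated by that seminorm.
  Injectivity is the inverse estimate once more, applied to a difference u - v and to singletons in
  the dual.\<close>

definition concavelike :: "'d set \<Rightarrow> 's set \<Rightarrow> ('d \<Rightarrow> 's \<Rightarrow> real) \<Rightarrow> bool" where
  "concavelike D K G \<longleftrightarrow> (\<forall>f\<in>K. \<forall>g\<in>K. \<forall>t. 0 \<le> t \<and> t \<le> 1 \<longrightarrow>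
     (\<exists>h\<in>K. \<forall>d\<in>D. (1 - t) * G d f + t * G d g \<le> G d h))"

lemma concavelikeD:
  assumes "concavelike D K G" "f \<in> K" "g \<in> K" "0 \<le> t" "t \<le> 1"
  obtains h where "h \<in> K" "\<And>d. d \<in> D \<Longrightarrow> (1 - t) * G d f + t * G d g \<le> G d h"
  using assms unfolding concavelike_def by meson

lemma concavelike_mono: "concavelike D K G \<Longrightarrow> D' \<subseteq> D \<Longrightarrow> concavelike D' K G"
  unfolding concavelike_def by (meson subsetD)

text \<open>The analogue of convexity of the superlevel sets of a concave function. Concave-likeness
  mentions no linear structure on K, so K may be replaced by such a subset in the induction
  below.\<close>

lemma concavelike_superlevel:
  assumes "concavelike D K G" "d \<in> D"
  shows "concavelike D {f \<in> K. 0 < G d f} G"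
  unfolding concavelike_def
proof (intro ballI allI impI)
  fix f g and t :: real
  assume f: "f \<in> {f \<in> K. 0 < G d f}" and g: "g \<in> {f \<in> K. 0 < G d f}" and t: "0 \<le> t \<and> t \<le> 1"
  obtain h where h: "h \<in> K" "\<And>e. e \<in> D \<Longrightarrow> (1 - t) * G e f + t * G e g \<le> G e h"
    using concavelikeD[OF assms(1), of f g t] f g t by auto
  have "0 < (1 - t) * G d f + t * G d g"
    using f g t by (cases "t = 1") (auto intro!: add_pos_nonneg mult_pos_pos)
  with h show "\<exists>h\<in>{f \<in> K. 0 < G d f}. \<forall>e\<in>D. (1 - t) * G e f + t * G e g \<le> G e h"
    using assms(2) by (intro bexI[of _ h]) (auto dest: less_le_trans)
qed

text \<open>The points (a f, b f) of the plane avoid the open positive quadrant. Concave-likeness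
  makes their downward closure convex, so a line through the origin with nonnegative normal
  separates them from that quadrant; its slope is constructed by hand.\<close>

lemma fan_alternative_two:
  fixes a b :: "'s \<Rightarrow> real"
  assumes conc: "\<And>f g t. f \<in> K \<Longrightarrow> g \<in> K \<Longrightarrow> 0 \<le> t \<Longrightarrow> t \<le> 1 \<Longrightarrow>
      \<exists>h\<in>K. (1 - t) * a f + t * a g \<le> a h \<and> (1 - t) * b f + t * b g \<le> b h"
    and alt: "\<And>f. f \<in> K \<Longrightarrow> a f \<le> 0 \<or> b f \<le> 0"
  shows "\<exists>s. 0 \<le> s \<and> s \<le> 1 \<and> (\<forall>f\<in>K. (1 - s) * a f + s * b f \<le> 0)"
proof (cases "(\<forall>f\<in>K. a f \<le> 0) \<or> (\<forall>f\<in>K. b f \<le> 0)")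
  case True
  then show ?thesis
  proof
    assume "\<forall>f\<in>K. a f \<le> 0"
    then show ?thesis by (intro exI[of _ 0]) simp
  next
    assume "\<forall>f\<in>K. b f \<le> 0"
    then show ?thesis by (intro exI[of _ 1]) simp
  qed
next
  case False
  then obtain f0 g0 where f0: "f0 \<in> K" "0 < a f0" and g0: "g0 \<in> K" "0 < b g0"
    by (auto simp: not_le)
  have cross: "a f * b g \<le> a g * b f" if f: "f \<in> K" "0 < a f" and g: "g \<in> K" "0 < b g" for f g
  proof (rule ccontr)
    assume c: "\<not> ?thesis"
    have bf: "b f \<le> 0" and ag: "a g \<le> 0" using alt f g by force+
    \<comment> \<open>at the point t of the segment both lower bounds equal \<open>(a f * b g - a g * b f) / N\<close>\<close>
    define N where "N = (a f - b f) + (b g - a g)"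
    have N: "N > 0" unfolding N_def using f g bf ag by linarith
    define t where "t = (a f - b f) / N"
    have t: "0 \<le> t" "t \<le> 1" using f g bf ag N by (auto simp: t_def N_def divide_simps)
    have t1: "1 - t = (b g - a g) / N" using N by (simp add: t_def N_def field_simps)
    obtain h where h: "h \<in> K" "(1 - t) * a f + t * a g \<le> a h" "(1 - t) * b f + t * b g \<le> b h"
      using conc[OF f(1) g(1) t] by blast
    have "(1 - t) * a f + t * a g = (a f * b g - a g * b f) / N"
      unfolding t1 unfolding t_def by (simp add: add_divide_distrib[symmetric] algebra_simps)
    moreover have "(1 - t) * b f + t * b g = (a f * b g - a g * b f) / N"
      unfolding t1 unfolding t_def by (simp add: add_divide_distrib[symmetric] algebra_simps)
    moreover have "(a f * b g - a g * b f) / N > 0" using c N by simp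
    ultimately show False using alt[OF h(1)] h by linarith
  qed
  \<comment> \<open>Strictness is what permits division by - b f in the slopes; it comes from
    comparing f with the one point g0 where b is positive.\<close>
  have bneg: "b f < 0" if "f \<in> K" "0 < a f" for f
  proof -
    have "0 < a f * b g0" using that g0 by simp
    then have "0 < a g0 * b f" using cross[OF that g0] by linarith
    moreover have "b f \<le> 0" using alt that by force
    ultimately show ?thesis by (cases "b f = 0") auto
  qed
  \<comment> \<open>A multiplier s with a + s * b nonpositive must be at least a f / (- b f) where a
    is positive, and at most - a g / b g where b is positive. \<open>cross\<close> says that these
    demands are compatible, so the supremum of the lower ones meets both.\<close>
  define R where "R = (\<lambda>f. a f / (- b f)) ` {f \<in> K. 0 < a f}"
  have ub: "r \<le> - a g / b g" if "r \<in> R" "g \<in> K" "0 < b g" for r g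
  proof -
    obtain f where f: "f \<in> K" "0 < a f" "r = a f / (- b f)" using \<open>r \<in> R\<close> unfolding R_def by blast
    have "a f * b g \<le> (- a g) * (- b f)" using cross[OF f(1,2) that(2,3)] by simp
    then have "a f \<le> (- a g) * (- b f) / b g" using that(3) by (subst pos_le_divide_eq)
    then have "a f \<le> (- a g / b g) * (- b f)" by simp
    then show ?thesis unfolding f(3) using bneg[OF f(1,2)] by (subst pos_divide_le_eq) auto
  qed
  have Rne: "R \<noteq> {}" using f0 unfolding R_def by auto
  have bdd: "bdd_above R" using ub[OF _ g0] by (intro bdd_aboveI)
  define s where "s = Sup R"
  have s_ge: "a f \<le> s * (- b f)" if "f \<in> K" "0 < a f" for f
  proof -
    have "a f / (- b f) \<le> s" unfolding s_def using that bdd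
      by (intro cSup_upper) (auto simp: R_def)
    then show ?thesis using bneg[OF that] by (subst (asm) pos_divide_le_eq) auto
  qed
  have s0: "0 \<le> s"
    using s_ge[OF f0] bneg[OF f0] f0 by (smt (verit) mult_nonneg_nonneg mult_le_0_iff)
  have key: "a f + s * b f \<le> 0" if f: "f \<in> K" for f
  proof (cases "0 < a f")
    case True
    then show ?thesis using s_ge[OF f] by simp
  next
    case na: False
    show ?thesis
    proof (cases "0 < b f")
      case True
      have "s \<le> - a f / b f" unfolding s_def using Rne ub[OF _ f True] by (intro cSup_least)
      then show ?thesis using True by (simp add: field_simps)
    next
      case False
      then have "s * b f \<le> 0" using s0 by (simp add: mult_nonneg_nonpos)
      then show ?thesis using na by linarith
    qed
  qed
  \<comment> \<open>Dividing the multipliers 1 and s by 1 + s makes them convex weights.\<close>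
  show ?thesis
  proof (intro exI[of _ "s / (1 + s)"] conjI ballI)
    fix f assume "f \<in> K"
    have "(1 - s / (1 + s)) * a f + s / (1 + s) * b f = (a f + s * b f) / (1 + s)"
      using s0 by (simp add: divide_simps)
    also have "\<dots> \<le> 0" using key[OF \<open>f \<in> K\<close>] s0 by (simp add: divide_nonpos_pos)
    finally show "(1 - s / (1 + s)) * a f + s / (1 + s) * b f \<le> 0" .
  qed (use s0 in auto)
qed

text \<open>Induction on the number of functions: the weights found for the old ones merge them into
  a single function, which the two-function case then balances against the new one.\<close>

lemma fan_alternative_finite:
  assumes "finite I" "I \<noteq> {}" "concavelike I K G"
    and "\<And>f. f \<in> K \<Longrightarrow> \<exists>d\<in>I. G d f \<le> 0"
  shows "\<exists>l. (\<forall>d\<in>I. 0 \<le> l d) \<and> sum l I = 1 \<and> (\<forall>f\<in>K. (\<Sum>d\<in>I. l d * G d f) \<le> 0)"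
  using assms
proof (induction I arbitrary: K rule: finite_ne_induct)
  case (singleton d)
  then show ?case by (intro exI[of _ "\<lambda>_. 1"]) auto
next
  case (insert e I)
  \<comment> \<open>Where G e is nonpositive the alternative already holds, so the induction
    hypothesis is used only on the rest of K, which may be empty; hence K is generalised in the
    induction.\<close>
  have "concavelike I {f \<in> K. 0 < G e f} G"
    using concavelike_mono[OF concavelike_superlevel[OF insert.prems(1), of e]] by blast
  moreover have "\<exists>d\<in>I. G d f \<le> 0" if "f \<in> {f \<in> K. 0 < G e f}" for f
    using insert.prems(2)[of f] that by auto
  ultimately obtain l where l: "\<And>d. d \<in> I \<Longrightarrow> 0 \<le> l d" "sum l I = 1"
      "\<And>f. f \<in> K \<Longrightarrow> 0 < G e f \<Longrightarrow> (\<Sum>d\<in>I. l d * G d f) \<le> 0"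
    using insert.IH by (smt (verit, best) mem_Collect_eq)
  let ?a = "\<lambda>f. \<Sum>d\<in>I. l d * G d f"
  have "\<exists>s. 0 \<le> s \<and> s \<le> 1 \<and> (\<forall>f\<in>K. (1 - s) * ?a f + s * G e f \<le> 0)"
  proof (rule fan_alternative_two)
    fix f g and t :: real
    assume f: "f \<in> K" "g \<in> K" "0 \<le> t" "t \<le> 1"
    obtain h where h: "h \<in> K" "\<And>d. d \<in> insert e I \<Longrightarrow> (1 - t) * G d f + t * G d g \<le> G d h"
      using concavelikeD[OF insert.prems(1) f] by metis
    have "(1 - t) * ?a f + t * ?a g = (\<Sum>d\<in>I. l d * ((1 - t) * G d f + t * G d g))"
      by (simp add: sum_distrib_left sum.distrib[symmetric] algebra_simps)
    also have "\<dots> \<le> ?a h" using h l by (intro sum_mono mult_left_mono) auto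
    finally show "\<exists>h\<in>K. (1 - t) * ?a f + t * ?a g \<le> ?a h \<and> (1 - t) * G e f + t * G e g \<le> G e h"
      using h by blast
  next
    fix f assume "f \<in> K"
    then show "?a f \<le> 0 \<or> G e f \<le> 0" using l(3) by force
  qed
  then obtain s where s: "0 \<le> s" "s \<le> 1" "\<And>f. f \<in> K \<Longrightarrow> (1 - s) * ?a f + s * G e f \<le> 0" by blast
  define l' where "l' d = (if d = e then s else (1 - s) * l d)" for d
  have l'I: "\<And>d. d \<in> I \<Longrightarrow> l' d = (1 - s) * l d" and l'e: "l' e = s"
    using insert.hyps by (auto simp: l'_def)
  have "sum l' I = (1 - s) * sum l I"
    by (simp add: sum_distrib_left l'I)
  then have "sum l' (insert e I) = 1" using insert.hyps l by (simp add: l'e)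
  moreover have "(\<Sum>d\<in>insert e I. l' d * G d f) \<le> 0" if "f \<in> K" for f
  proof -
    have "(\<Sum>d\<in>I. l' d * G d f) = (1 - s) * ?a f"
      by (simp add: sum_distrib_left l'I mult.assoc)
    then show ?thesis using s(3)[OF that] insert.hyps by (simp add: l'e)
  qed
  moreover have "\<forall>d\<in>insert e I. 0 \<le> l' d" using s l by (auto simp: l'_def)
  ultimately show ?case by blast
qed

text \<open>The strict inequality in \<open>alt\<close> makes the sets where G d is negative open,
  so finitely many of them cover K. Since K is nonempty at least one index survives, and weights
  with sum 1 exist.\<close>

lemma fan_alternative_compact:
  assumes K: "compactin Tp K" "K \<noteq> {}"
    and cont: "\<And>d. d \<in> D \<Longrightarrow> continuous_map Tp euclideanreal (G d)"
    and conc: "concavelike D K G"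
    and alt: "\<And>f. f \<in> K \<Longrightarrow> \<exists>d\<in>D. G d f < 0"
  shows "\<exists>I l. finite I \<and> I \<subseteq> D \<and> (\<forall>d\<in>I. 0 \<le> l d) \<and> sum l I = 1 \<and>
    (\<forall>f\<in>K. (\<Sum>d\<in>I. l d * G d f) \<le> 0)"
proof -
  let ?U = "\<lambda>d. {f \<in> topspace Tp. G d f \<in> {..<0}}"
  have "K \<subseteq> (\<Union>d\<in>D. ?U d)"
    using alt compactin_subset_topspace[OF K(1)] by fastforce
  moreover have "openin Tp (?U d)" if "d \<in> D" for d
    using openin_continuous_map_preimage[OF cont[OF that], of "{..<0}"] by simp
  ultimately obtain I where I: "finite I" "I \<subseteq> D" "K \<subseteq> (\<Union>d\<in>I. ?U d)"
    using K(1) unfolding compactin_def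
    by (smt (verit, ccfv_SIG) finite_subset_image image_iff)
  have "I \<noteq> {}" using I K(2) by auto
  moreover have "\<exists>d\<in>I. G d f \<le> 0" if "f \<in> K" for f
    using subsetD[OF I(3) that] by (auto intro: less_imp_le)
  ultimately have "\<exists>l. (\<forall>d\<in>I. 0 \<le> l d) \<and> sum l I = 1 \<and> (\<forall>f\<in>K. (\<Sum>d\<in>I. l d * G d f) \<le> 0)"
    using fan_alternative_finite[OF I(1) _ concavelike_mono[OF conc I(2)]] by blast
  then show ?thesis using I(1,2) by (intro exI[of _ I]) simp
qed

section \<open>A real part on a real normed field\<close>

definition re_quot :: "'k::real_normed_field \<Rightarrow> real \<Rightarrow> real" where
  "re_quot z t = (norm (1 + of_real t * z) - 1) / t"

text \<open>The one-sided derivative of the norm at 1 in direction z, i.e. the real part of z.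
  It is always sublinear; it is linear because the norm is multiplicative, which gives
  |1 + tz| |1 - tz| \<open>\<le>\<close> 1 + t^2 |z|^2.\<close>

definition re_part :: "'k::real_normed_field \<Rightarrow> real" where
  "re_part z = (INF t\<in>{0<..}. re_quot z t)"

lemma re_quot_bounds:
  assumes "0 < t"
  shows "- norm z \<le> re_quot z t" "re_quot z t \<le> norm z"
proof -
  have n: "norm (of_real t * z) = t * norm z" using assms by (simp add: norm_mult)
  have "1 - t * norm z \<le> norm (1 + of_real t * z)"
    using norm_diff_ineq[of 1 "of_real t * z"] n by simp
  then show "- norm z \<le> re_quot z t" using assms by (simp add: re_quot_def field_simps)
  have "norm (1 + of_real t * z) \<le> 1 + t * norm z"
    using norm_triangle_ineq[of 1 "of_real t * z"] n by simp
  then show "re_quot z t \<le> norm z" using assms by (simp add: re_quot_def field_simps)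
qed

lemma bdd_below_re_quot: "bdd_below (re_quot z ` {0<..})"
  using re_quot_bounds(1) by (intro bdd_belowI2) auto

lemma re_part_le_quot: "0 < t \<Longrightarrow> re_part z \<le> re_quot z t"
  unfolding re_part_def using bdd_below_re_quot by (intro cINF_lower) auto

lemma re_part_greatest: "(\<And>t. 0 < t \<Longrightarrow> c \<le> re_quot z t) \<Longrightarrow> c \<le> re_part z"
  unfolding re_part_def by (intro cINF_greatest) auto

text \<open>The map taking t to the norm of 1 + t z is convex with value 1 at 0, so its difference
  quotients at 0 increase with t; the infimum in \<open>re_part\<close> is therefore the limit at
  0.\<close>

lemma re_quot_mono:
  assumes "0 < s" "s \<le> t"
  shows "re_quot z s \<le> re_quot z t"
proof -
  have "1 + of_real s * z = of_real (1 - s / t) + of_real (s / t) * (1 + of_real t * z)"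
    using assms by (simp add: algebra_simps)
  then have "norm (1 + of_real s * z) \<le> (1 - s / t) + (s / t) * norm (1 + of_real t * z)"
    using assms norm_triangle_ineq[of "of_real (1 - s / t)" "of_real (s / t) * (1 + of_real t * z)"]
    by (simp only: norm_mult norm_of_real) simp
  then have "norm (1 + of_real s * z) - 1 \<le> s / t * (norm (1 + of_real t * z) - 1)"
    by (simp add: algebra_simps)
  then have "re_quot z s \<le> s / t * (norm (1 + of_real t * z) - 1) / s"
    unfolding re_quot_def using assms by (intro divide_right_mono) auto
  then show ?thesis using assms by (simp add: re_quot_def)
qed

lemma re_part_le_norm: "re_part z \<le> norm z"
  using re_part_le_quot[of 1 z] re_quot_bounds(2)[of 1 z] by simp

lemma re_part_subadd: "re_part (x + y) \<le> re_part x + re_part y"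
proof -
  \<comment> \<open>Midpoint convexity of the norm: 1 + t (x + y) is the midpoint of 1 + 2 t x and 1
    + 2 t y.\<close>
  have half: "re_quot (x + y) t \<le> re_quot x (2 * t) + re_quot y (2 * t)" if "0 < t" for t
  proof -
    have "2 * (1 + of_real t * (x + y)) = (1 + of_real (2 * t) * x) + (1 + of_real (2 * t) * y)"
      by (simp add: algebra_simps)
    then have "2 * norm (1 + of_real t * (x + y))
        \<le> norm (1 + of_real (2 * t) * x) + norm (1 + of_real (2 * t) * y)"
      by (metis norm_triangle_ineq norm_mult norm_numeral)
    then have "(2 * norm (1 + of_real t * (x + y)) - 2) / (2 * t)
        \<le> (norm (1 + of_real (2 * t) * x) + norm (1 + of_real (2 * t) * y) - 2) / (2 * t)"
      using that by (intro divide_right_mono) auto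
    moreover have "re_quot (x + y) t = (2 * norm (1 + of_real t * (x + y)) - 2) / (2 * t)"
      using that by (simp add: re_quot_def divide_simps)
    ultimately show ?thesis
      by (simp add: re_quot_def diff_divide_distrib add_divide_distrib)
  qed
  \<comment> \<open>The parameters s and t are independent, so that the two infima can be taken one
    after the other; monotonicity lowers both to their minimum.\<close>
  have "re_part (x + y) \<le> re_quot x s + re_quot y t" if "0 < s" "0 < t" for s t
  proof -
    have m: "0 < min s t / 2" using that by simp
    have "re_part (x + y) \<le> re_quot x (min s t) + re_quot y (min s t)"
      using re_part_le_quot[OF m, of "x + y"] half[OF m] by simp
    also have "\<dots> \<le> re_quot x s + re_quot y t"
      using that by (intro add_mono re_quot_mono) auto
    finally show ?thesis .
  qed
  then have "re_part (x + y) - re_quot x s \<le> re_part y" if "0 < s" for s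
    using that by (intro re_part_greatest) (simp add: algebra_simps)
  then have "re_part (x + y) - re_part y \<le> re_part x"
    by (intro re_part_greatest) (simp add: algebra_simps)
  then show ?thesis by simp
qed

lemma re_part_uminus_le: "re_part z + re_part (- z) \<le> 0"
proof (rule field_le_epsilon)
  fix e :: real assume e: "0 < e"
  define r where "r = norm z"
  \<comment> \<open>The two quotients will add up to at most 2 * t * r^2, which this t keeps below
    e; the added 1 covers z = 0.\<close>
  define t where "t = e / (2 * r\<^sup>2 + 1)"
  have den: "0 < 2 * r\<^sup>2 + 1" by (simp add: add_nonneg_pos)
  have t: "0 < t" using e den by (simp add: t_def)
  define a b where "a = norm (1 + of_real t * z)" and "b = norm (1 + of_real t * (- z))"
  have "a * b = norm (1 - (of_real t * z)\<^sup>2)"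
    unfolding a_def b_def norm_mult[symmetric] by (simp add: algebra_simps power2_eq_square)
  also have "\<dots> \<le> 1 + (t * r)\<^sup>2"
    using norm_triangle_ineq4[of 1 "(of_real t * z)\<^sup>2"] t by (simp add: norm_power norm_mult r_def)
  finally have ab: "a * b \<le> 1 + (t * r)\<^sup>2" .
  have "\<bar>re_quot z t\<bar> \<le> r" "\<bar>re_quot (- z) t\<bar> \<le> r"
    using re_quot_bounds[OF t, of z] re_quot_bounds[OF t, of "- z"] by (auto simp: r_def)
  then have "\<bar>a - 1\<bar> \<le> t * r" "\<bar>b - 1\<bar> \<le> t * r"
    using t by (auto simp: re_quot_def a_def b_def abs_divide field_simps)
  then have "\<bar>a - 1\<bar> * \<bar>b - 1\<bar> \<le> (t * r) * (t * r)"
    by (intro mult_mono) auto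
  then have "\<bar>(a - 1) * (b - 1)\<bar> \<le> (t * r)\<^sup>2" by (simp add: abs_mult power2_eq_square)
  \<comment> \<open>Multiplicativity controls only the product of a and b. Their sum differs from it
    by a second-order term, because both are within t * r of 1; this survives division by t.\<close>
  moreover have "a + b - 2 = a * b - 1 - (a - 1) * (b - 1)" by (simp add: algebra_simps)
  ultimately have s: "a + b - 2 \<le> 2 * (t * r)\<^sup>2" using ab by linarith
  have "re_part z + re_part (- z) \<le> re_quot z t + re_quot (- z) t"
    by (intro add_mono re_part_le_quot t)
  also have "\<dots> = (a + b - 2) / t" by (simp add: re_quot_def a_def b_def diff_divide_distrib add_divide_distrib)
  also have "\<dots> \<le> 2 * (t * r)\<^sup>2 / t" using s t by (intro divide_right_mono) auto
  also have "\<dots> = t * (2 * r\<^sup>2)" using t by (simp add: power2_eq_square)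
  also have "\<dots> \<le> t * (2 * r\<^sup>2 + 1)" using t by simp
  also have "\<dots> = e" using den by (simp add: t_def)
  finally show "re_part z + re_part (- z) \<le> 0 + e" by simp
qed

lemma re_part_zero [simp]: "re_part 0 = 0"
  by (simp add: re_part_def re_quot_def)

lemma re_part_uminus: "re_part (- z) = - re_part z"
  using re_part_uminus_le[of z] re_part_subadd[of z "- z"] by simp

lemma re_part_add: "re_part (x + y) = re_part x + re_part y"
  using re_part_subadd[of x y] re_part_subadd[of "- x" "- y"] re_part_uminus[of "x + y"]
  by (simp add: re_part_uminus)

lemma re_part_diff: "re_part (x - y) = re_part x - re_part y"
  using re_part_add[of x "- y"] by (simp add: re_part_uminus)

lemma re_part_sum: "re_part (sum g I) = (\<Sum>i\<in>I. re_part (g i))"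
  by (induction I rule: infinite_finite_induct) (auto simp: re_part_add)

text \<open>Rescaling the parameter t by c gives one inequality; the same inequality for inverse c
  gives the other.\<close>

lemma re_part_of_real_mult:
  assumes "0 \<le> c"
  shows "re_part (of_real c * z) = c * re_part z"
proof (cases "c = 0")
  case False
  have le: "c * re_part z \<le> re_part (of_real c * z)" if "0 < c" for c and z :: 'a
  proof (rule re_part_greatest)
    fix t :: real assume "0 < t"
    then have "re_part z \<le> re_quot z (c * t)" using that by (intro re_part_le_quot) simp
    then have "c * re_part z \<le> c * re_quot z (c * t)" using that by simp
    also have "\<dots> = re_quot (of_real c * z) t"
      using that by (simp add: re_quot_def mult_ac)
    finally show "c * re_part z \<le> re_quot (of_real c * z) t" .
  qed
  have c: "0 < c" using False assms by simp
  have "inverse c * re_part (of_real c * z) \<le> re_part z"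
    using le[of "inverse c" "of_real c * z"] c by (simp add: mult.assoc[symmetric])
  then show ?thesis using le[OF c, of z] c by (simp add: field_simps)
qed simp

lemma re_part_of_real:
  assumes "0 \<le> c"
  shows "re_part (of_real c :: 'k::real_normed_field) = c"
proof -
  have "re_quot (1::'k) t = 1" if "0 < t" for t
  proof -
    have "1 + of_real t * (1::'k) = of_real (1 + t)" by simp
    then have "norm (1 + of_real t * (1::'k)) = 1 + t" using that by (simp only: norm_of_real)
    then show ?thesis using that by (simp add: re_quot_def)
  qed
  then have "re_part (1::'k) = 1" by (simp add: re_part_def)
  then show ?thesis using re_part_of_real_mult[OF assms, of "1::'k"] by simp
qed

lemma abs_re_part_le: "\<bar>re_part z\<bar> \<le> norm z"
  using re_part_le_norm[of z] re_part_le_norm[of "- z"] by (simp add: re_part_uminus)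

text \<open>Converts moduli into real parts: over a set closed under unimodular multiples, bounding
  the real part bounds the modulus.\<close>

lemma unimodular_rotation:
  fixes z :: "'k::real_normed_field"
  obtains a where "norm a = 1" "a * z = of_real (norm z)"
proof (cases "z = 0")
  case True
  then show thesis using that[of 1] by simp
next
  case False
  then show thesis using that[of "of_real (norm z) / z"] by (simp add: norm_divide)
qed

section \<open>Seminorm topologies and duals\<close>

lemma fun_subspaceD:
  "fun_subspace sc X \<Longrightarrow> f \<in> X \<Longrightarrow> g \<in> X \<Longrightarrow> (\<lambda>w. sc a (f w) + sc b (g w)) \<in> X"
  by (simp add: fun_subspace_def)

lemma fun_lin_onD:
  "fun_lin_on sc X sc' u \<Longrightarrow> f \<in> X \<Longrightarrow> g \<in> X \<Longrightarrow>
    u (\<lambda>w. sc a (f w) + sc b (g w)) = sc' a (u f) + sc' b (u g)"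
  by (simp add: fun_lin_on_def)

lemma fun_subspace_sum:
  assumes X: "fun_subspace (*) (X :: ('z \<Rightarrow> 'k::field) set)" and "\<And>i. i \<in> I \<Longrightarrow> f i \<in> X"
  shows "(\<lambda>w. \<Sum>i\<in>I. c i * f i w) \<in> X"
  using assms(2)
proof (induction I rule: infinite_finite_induct)
  case (insert i I)
  then have "(\<lambda>w. c i * f i w + 1 * (\<Sum>i\<in>I. c i * f i w)) \<in> X"
    by (intro fun_subspaceD[OF X]) auto
  then show ?case using insert.hyps by simp
qed (use X in \<open>auto simp: fun_subspace_def\<close>)

lemma fun_lin_on_sum:
  assumes X: "fun_subspace (*) (X :: ('z \<Rightarrow> 'k::field) set)" and u: "fun_lin_on (*) X sc u"
    and vs: "Vector_Spaces.vector_space sc" and "\<And>i. i \<in> I \<Longrightarrow> f i \<in> X"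
  shows "u (\<lambda>w. \<Sum>i\<in>I. c i * f i w) = (\<Sum>i\<in>I. sc (c i) (u (f i)))"
proof -
  interpret vector_space sc by fact
  have zero: "u (\<lambda>_. 0) = 0"
  proof -
    have "(\<lambda>_. 0) \<in> X" using X by (simp add: fun_subspace_def)
    then show ?thesis using fun_lin_onD[OF u, of "\<lambda>_. 0" "\<lambda>_. 0" 0 0] by simp
  qed
  show ?thesis using assms(4)
  proof (induction I rule: infinite_finite_induct)
    case (insert i I)
    have "(\<lambda>w. \<Sum>i\<in>I. c i * f i w) \<in> X" using insert.prems by (intro fun_subspace_sum[OF X]) auto
    then have "u (\<lambda>w. c i * f i w + 1 * (\<Sum>i\<in>I. c i * f i w))
        = sc (c i) (u (f i)) + sc 1 (u (\<lambda>w. \<Sum>i\<in>I. c i * f i w))"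
      using insert.prems by (intro fun_lin_onD[OF u]) auto
    then show ?case using insert by simp
  qed (simp_all add: zero)
qed

lemma vector_space_mult: "Vector_Spaces.vector_space ((*) :: 'k::field \<Rightarrow> 'k \<Rightarrow> 'k)"
  by unfold_locales (simp_all add: algebra_simps)

lemma fun_subspace_diff:
  assumes "fun_subspace sc X" "Vector_Spaces.vector_space sc" "f \<in> X" "g \<in> X"
  shows "(\<lambda>w. f w - g w) \<in> X"
proof -
  interpret vector_space sc by fact
  show ?thesis using fun_subspaceD[OF assms(1,3,4), of 1 "-1"] by simp
qed

lemma fun_lin_on_diff:
  assumes "fun_lin_on sc X sc' u" "Vector_Spaces.vector_space sc" "Vector_Spaces.vector_space sc'"
    "f \<in> X" "g \<in> X"
  shows "u (\<lambda>w. f w - g w) = u f - u g"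
proof -
  interpret vector_space sc by fact
  interpret v': vector_space sc' by fact
  show ?thesis using fun_lin_onD[OF assms(1,4,5), of 1 "-1"] by simp
qed

section \<open>Seminorms and the topology they generate\<close>

lemma is_seminormD:
  assumes "is_seminorm sc q"
  shows "0 \<le> q x" "q (sc a x) = norm a * q x" "q (x + y) \<le> q x + q y"
  using assms by (simp_all add: is_seminorm_def)

lemma is_seminorm_zero:
  assumes "is_seminorm sc q" "Vector_Spaces.vector_space sc"
  shows "q 0 = 0"
proof -
  interpret vector_space sc by fact
  show ?thesis using is_seminormD(2)[OF assms(1), of 0 0] by simp
qed

lemma is_seminorm_sum_le:
  assumes q: "is_seminorm sc q" "Vector_Spaces.vector_space sc"
  shows "q (\<Sum>i\<in>I. sc (c i) (f i)) \<le> (\<Sum>i\<in>I. norm (c i) * q (f i))"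
proof (induction I rule: infinite_finite_induct)
  case (insert i I)
  have "q (sc (c i) (f i) + (\<Sum>i\<in>I. sc (c i) (f i)))
      \<le> norm (c i) * q (f i) + q (\<Sum>i\<in>I. sc (c i) (f i))"
    using is_seminormD(3)[OF q(1)] by (simp add: is_seminormD(2)[OF q(1), symmetric])
  then show ?case using insert by simp
qed (simp_all add: is_seminorm_zero[OF q])

text \<open>Closure under intersection rests on one fact: a larger finite index set and a smaller
  radius give a smaller neighbourhood. Keeping N abstract isolates it from the form of the seminorm
  balls.\<close>

lemma istopology_finite_nbhds:
  fixes N :: "'b \<Rightarrow> 'i set \<Rightarrow> real \<Rightarrow> 'b set"
  assumes N: "\<And>f F F' e e'. N f (F \<union> F') (min e e') \<subseteq> N f F e \<inter> N f F' e'"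
  shows "istopology (\<lambda>U. U \<subseteq> X \<and> (\<forall>f\<in>U. \<exists>F \<epsilon>. finite F \<and> F \<subseteq> I \<and> \<epsilon> > 0 \<and> N f F \<epsilon> \<subseteq> U))"
    (is "istopology ?P")
  unfolding istopology_def
proof (intro conjI allI impI)
  fix U V assume U: "?P U" and V: "?P V"
  show "U \<inter> V \<subseteq> X" using conjunct1[OF U] by (rule le_infI1)
  show "\<forall>f\<in>U \<inter> V. \<exists>F \<epsilon>. finite F \<and> F \<subseteq> I \<and> \<epsilon> > 0 \<and> N f F \<epsilon> \<subseteq> U \<inter> V"
  proof
    fix f assume f: "f \<in> U \<inter> V"
    obtain F e where F: "finite F" "F \<subseteq> I" "e > 0" "N f F e \<subseteq> U"
      using bspec[OF conjunct2[OF U] IntD1[OF f]] by (elim exE conjE) (rule that)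
    obtain F' e' where F': "finite F'" "F' \<subseteq> I" "e' > 0" "N f F' e' \<subseteq> V"
      using bspec[OF conjunct2[OF V] IntD2[OF f]] by (elim exE conjE) (rule that)
    have "N f (F \<union> F') (min e e') \<subseteq> U \<inter> V" using F(4) F'(4) N[of f F F' e e'] by blast
    then show "\<exists>F \<epsilon>. finite F \<and> F \<subseteq> I \<and> \<epsilon> > 0 \<and> N f F \<epsilon> \<subseteq> U \<inter> V"
      using F F' by (intro exI[of _ "F \<union> F'"] exI[of _ "min e e'"]) simp
  qed
next
  fix \<U> assume H: "\<forall>K\<in>\<U>. ?P K"
  show "\<Union>\<U> \<subseteq> X" using H by (intro Sup_least) simp
  show "\<forall>f\<in>\<Union>\<U>. \<exists>F \<epsilon>. finite F \<and> F \<subseteq> I \<and> \<epsilon> > 0 \<and> N f F \<epsilon> \<subseteq> \<Union>\<U>"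
  proof
    fix f assume "f \<in> \<Union>\<U>"
    then obtain K where K: "K \<in> \<U>" "f \<in> K" by blast
    obtain F e where F: "finite F" "F \<subseteq> I" "e > 0" "N f F e \<subseteq> K"
      using bspec[OF conjunct2[OF bspec[OF H K(1)]] K(2)] by (elim exE conjE) (rule that)
    have "N f F e \<subseteq> \<Union>\<U>" using F(4) K(1) by (rule Sup_upper2[rotated])
    then show "\<exists>F \<epsilon>. finite F \<and> F \<subseteq> I \<and> \<epsilon> > 0 \<and> N f F \<epsilon> \<subseteq> \<Union>\<U>"
      using F by (intro exI[of _ F] exI[of _ e] conjI)
  qed
qed

lemma openin_sn_topology:
  "openin (sn_topology X I q) U \<longleftrightarrow> U \<subseteq> X \<and> (\<forall>f\<in>U. \<exists>F \<epsilon>. finite F \<and> F \<subseteq> I \<and> \<epsilon> > 0 \<and>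
     {g\<in>X. \<forall>i\<in>F. q i (\<lambda>w. g w - f w) < \<epsilon>} \<subseteq> U)"
proof -
  have "istopology (\<lambda>U. U \<subseteq> X \<and> (\<forall>f\<in>U. \<exists>F \<epsilon>. finite F \<and> F \<subseteq> I \<and> \<epsilon> > 0 \<and>
      {g\<in>X. \<forall>i\<in>F. q i (\<lambda>w. g w - f w) < \<epsilon>} \<subseteq> U))"
    by (rule istopology_finite_nbhds[where N = "\<lambda>f F \<epsilon>. {g\<in>X. \<forall>i\<in>F. q i (\<lambda>w. g w - f w) < \<epsilon>}"])
      auto
  then show ?thesis unfolding sn_topology_def by (simp only: topology_inverse')
qed

lemma topspace_sn_topology [simp]: "topspace (sn_topology X I q) = X"
proof (rule antisym)
  show "topspace (sn_topology X I q) \<subseteq> X" 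
    by (rule openin_sn_topology[THEN iffD1, THEN conjunct1, OF openin_topspace])
  have "openin (sn_topology X I q) X" unfolding openin_sn_topology
  proof (intro conjI ballI)
    fix f assume "f \<in> X"
    show "\<exists>F \<epsilon>. finite F \<and> F \<subseteq> I \<and> \<epsilon> > 0 \<and> {g\<in>X. \<forall>i\<in>F. q i (\<lambda>w. g w - f w) < \<epsilon>} \<subseteq> X"
      by (rule exI[of _ "{}"], rule exI[of _ 1]) simp
  qed simp
  then show "X \<subseteq> topspace (sn_topology X I q)" by (rule openin_subset)
qed

lemma continuous_map_sn_topology:
  fixes G :: "('z \<Rightarrow> 'e::ab_group_add) \<Rightarrow> real"
  assumes F: "finite F" "F \<subseteq> I" and C: "0 \<le> C"
    and lip: "\<And>f g. f \<in> X \<Longrightarrow> g \<in> X \<Longrightarrow> \<bar>G g - G f\<bar> \<le> C * (\<Sum>i\<in>F. q i (\<lambda>w. g w - f w))"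
  shows "continuous_map (sn_topology X I q) euclideanreal G"
  unfolding continuous_map_def
proof (intro conjI allI impI)
  fix U :: "real set" assume "openin euclideanreal U"
  then have U: "open U" by simp
  show "openin (sn_topology X I q) {f \<in> topspace (sn_topology X I q). G f \<in> U}"
    unfolding openin_sn_topology
  proof (intro conjI ballI)
    fix f assume "f \<in> {f \<in> topspace (sn_topology X I q). G f \<in> U}"
    then have f: "f \<in> X" "G f \<in> U" by auto
    obtain e where e: "0 < e" "\<And>y. dist y (G f) < e \<Longrightarrow> y \<in> U"
      using U f(2) unfolding open_dist by blast
    \<comment> \<open>The summands 1 in n and in C + 1 keep the radius d well defined when F is
      empty or C = 0, and make the estimate below strict.\<close>
    define n where "n = real (card F) + 1"
    define d where "d = e / ((C + 1) * n)"
    have n: "0 < n" by (simp add: n_def)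
    have d: "0 < d" using e n C by (simp add: d_def)
    have "G g \<in> U" if g: "g \<in> X" "\<forall>i\<in>F. q i (\<lambda>w. g w - f w) < d" for g
    proof -
      let ?s = "\<Sum>i\<in>F. q i (\<lambda>w. g w - f w)"
      have s: "?s \<le> card F * d" using g(2) by (intro sum_bounded_above) auto
      have "C * ?s \<le> C * (card F * d)" using s C by (intro mult_left_mono)
      also have "\<dots> < (C + 1) * (n * d)"
        by (rule mult_strict_mono') (use d C in \<open>auto simp: n_def distrib_right\<close>)
      also have "\<dots> = e" using n C by (simp add: d_def)
      finally have "C * ?s < e" .
      then have "dist (G g) (G f) < e" using lip[OF f(1) g(1)] by (simp add: dist_real_def)
      then show ?thesis by (rule e)
    qed
    then show "\<exists>F \<epsilon>. finite F \<and> F \<subseteq> I \<and> \<epsilon> > 0 \<and>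
        {g\<in>X. \<forall>i\<in>F. q i (\<lambda>w. g w - f w) < \<epsilon>} \<subseteq> {f \<in> topspace (sn_topology X I q). G f \<in> U}"
      using F d by (intro exI[of _ F] exI[of _ d]) auto
  qed auto
qed auto

section \<open>Approximation in the kappa-topology\<close>

text \<open>Nonnegativity of the q i on X allows a constant of unknown sign to be replaced by its
  absolute value and a finite index set to be enlarged in the bounds.\<close>

locale seminormed_fun_space =
  fixes X :: "('w \<Rightarrow> 'k::real_normed_field) set" and I :: "'i set" and q :: "'i \<Rightarrow> ('w \<Rightarrow> 'k) \<Rightarrow> real"
  assumes sub: "fun_subspace (*) X"
    and nonneg: "i \<in> I \<Longrightarrow> f \<in> X \<Longrightarrow> 0 \<le> q i f"
begin

abbreviation dual where "dual \<equiv> sn_dual X I q"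

lemma dual_bound:
  assumes "y \<in> dual"
  obtains F C where "finite F" "F \<subseteq> I" "0 \<le> C" "\<And>f. f \<in> X \<Longrightarrow> norm (y f) \<le> C * (\<Sum>i\<in>F. q i f)"
proof -
  obtain F C where F: "finite F" "F \<subseteq> I" and C: "\<And>f. f \<in> X \<Longrightarrow> norm (y f) \<le> C * (\<Sum>i\<in>F. q i f)"
    using assms unfolding sn_dual_def sn_cont_def by (auto intro: that)
  have "norm (y f) \<le> \<bar>C\<bar> * (\<Sum>i\<in>F. q i f)" if "f \<in> X" for f
  proof -
    have "0 \<le> (\<Sum>i\<in>F. q i f)" using F(2) that nonneg by (intro sum_nonneg) auto
    then have "C * (\<Sum>i\<in>F. q i f) \<le> \<bar>C\<bar> * (\<Sum>i\<in>F. q i f)" by (intro mult_right_mono) auto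
    then show ?thesis using C[OF that] by linarith
  qed
  then show thesis by (rule that[OF F abs_ge_zero])
qed

lemma dualI:
  assumes "fun_lin_on (*) X (*) y" "\<And>f. f \<notin> X \<Longrightarrow> y f = 0"
    "finite F" "F \<subseteq> I" "\<And>f. f \<in> X \<Longrightarrow> norm (y f) \<le> C * (\<Sum>i\<in>F. q i f)"
  shows "y \<in> dual"
proof -
  have "\<exists>F C. finite F \<and> F \<subseteq> I \<and> (\<forall>f\<in>X. norm (y f) \<le> C * (\<Sum>i\<in>F. q i f))"
    using assms(3-5) by (intro exI[of _ F] exI[of _ C]) simp
  then show ?thesis using assms(1,2) by (simp add: sn_dual_def sn_cont_def)
qed

lemma dual_lin: "y \<in> dual \<Longrightarrow> fun_lin_on (*) X (*) y"
  by (simp add: sn_dual_def)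

lemma dual_outside: "y \<in> dual \<Longrightarrow> f \<notin> X \<Longrightarrow> y f = 0"
  by (simp add: sn_dual_def)

lemma dual_subspace: "fun_subspace (*) dual"
  unfolding fun_subspace_def
proof (intro conjI ballI allI)
  show "(\<lambda>_. 0) \<in> dual"
    by (rule dualI[of _ "{}" 0]) (auto simp: fun_lin_on_def)
next
  fix y z a b assume y: "y \<in> dual" and z: "z \<in> dual"
  obtain F C where F: "finite F" "F \<subseteq> I" "0 \<le> C" "\<And>f. f \<in> X \<Longrightarrow> norm (y f) \<le> C * (\<Sum>i\<in>F. q i f)"
    using dual_bound[OF y] by metis
  obtain F' C' where F': "finite F'" "F' \<subseteq> I" "0 \<le> C'" "\<And>f. f \<in> X \<Longrightarrow> norm (z f) \<le> C' * (\<Sum>i\<in>F'. q i f)"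
    using dual_bound[OF z] by metis
  show "(\<lambda>f. a * y f + b * z f) \<in> dual"
  proof (rule dualI[of _ "F \<union> F'" "norm a * C + norm b * C'"])
    show "fun_lin_on (*) X (*) (\<lambda>f. a * y f + b * z f)"
      using dual_lin[OF y] dual_lin[OF z] by (simp add: fun_lin_on_def algebra_simps)
    fix f assume f: "f \<in> X"
    have S: "(\<Sum>i\<in>F. q i f) \<le> (\<Sum>i\<in>F\<union>F'. q i f)" "(\<Sum>i\<in>F'. q i f) \<le> (\<Sum>i\<in>F\<union>F'. q i f)"
      using F F' f nonneg by (auto intro!: sum_mono2)
    have "norm (a * y f + b * z f) \<le> norm a * norm (y f) + norm b * norm (z f)"
      using norm_triangle_ineq[of "a * y f" "b * z f"] by (simp add: norm_mult)
    also have "\<dots> \<le> norm a * (C * (\<Sum>i\<in>F\<union>F'. q i f)) + norm b * (C' * (\<Sum>i\<in>F\<union>F'. q i f))"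
    proof (intro add_mono mult_left_mono)
      show "norm (y f) \<le> C * (\<Sum>i\<in>F\<union>F'. q i f)"
        using F(4)[OF f] mult_left_mono[OF S(1) F(3)] by linarith
      show "norm (z f) \<le> C' * (\<Sum>i\<in>F\<union>F'. q i f)"
        using F'(4)[OF f] mult_left_mono[OF S(2) F'(3)] by linarith
    qed auto
    finally show "norm (a * y f + b * z f) \<le> (norm a * C + norm b * C') * (\<Sum>i\<in>F\<union>F'. q i f)"
      by (simp add: algebra_simps)
  qed (use F F' dual_outside[OF y] dual_outside[OF z] in auto)
qed

text \<open>The 1-Lipschitz function h is left free because both the norm, for attaining
  kappa-seminorms, and \<open>re_part\<close>, for Fan's alternative, are composed with
  functionals.\<close>

lemma continuous_map_dual:
  fixes h :: "'k \<Rightarrow> real"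
  assumes y: "y \<in> dual" and h: "\<And>a b. \<bar>h a - h b\<bar> \<le> norm (a - b)"
  shows "continuous_map (sn_topology X I q) euclideanreal (\<lambda>f. h (y f))"
proof -
  obtain F C where F: "finite F" "F \<subseteq> I" "0 \<le> C" "\<And>f. f \<in> X \<Longrightarrow> norm (y f) \<le> C * (\<Sum>i\<in>F. q i f)"
    using dual_bound[OF y] by metis
  show ?thesis
  proof (rule continuous_map_sn_topology[OF F(1-3)])
    fix f g assume f: "f \<in> X" and g: "g \<in> X"
    have "\<bar>h (y g) - h (y f)\<bar> \<le> norm (y (\<lambda>w. g w - f w))"
      using h fun_lin_on_diff[OF dual_lin[OF y] vector_space_mult vector_space_mult g f] by simp
    also have "\<dots> \<le> C * (\<Sum>i\<in>F. q i (\<lambda>w. g w - f w))"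
      by (intro F(4) fun_subspace_diff[OF sub vector_space_mult] f g)
    finally show "\<bar>h (y g) - h (y f)\<bar> \<le> C * (\<Sum>i\<in>F. q i (\<lambda>w. g w - f w))" .
  qed
qed

text \<open>Compactness gives a point where the modulus is maximal; absolute convexity allows it to
  be rotated inside K until the value is real and nonnegative. A kappa-seminorm thus becomes a real
  part at a point, which Fan's alternative can handle.\<close>

lemma kappa_sn_attained:
  assumes y: "y \<in> dual" and K: "K \<in> kappa_idx X I q"
  obtains f where "f \<in> K" "kappa_sn K y = re_part (y f)" "0 \<le> kappa_sn K y"
proof -
  have K': "K \<noteq> {}" "K \<subseteq> X" "abs_convex (*) K" "compactin (sn_topology X I q) K"
    using K by (auto simp: kappa_idx_def)
  have "continuous_map (sn_topology X I q) euclideanreal (\<lambda>f. norm (y f))"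
    by (rule continuous_map_dual[OF y]) (rule norm_triangle_ineq3)
  then have "compact ((\<lambda>f. norm (y f)) ` K)"
    using image_compactin[OF K'(4), of euclideanreal "\<lambda>f. norm (y f)"] by simp
  then obtain f where f: "f \<in> K" "\<And>g. g \<in> K \<Longrightarrow> norm (y g) \<le> norm (y f)"
    using compact_attains_sup[of "(\<lambda>f. norm (y f)) ` K"] K'(1) by auto
  have sup: "kappa_sn K y = norm (y f)"
    unfolding kappa_sn_def using f by (intro cSup_eq_maximum) auto
  obtain a where a: "norm a = 1" "a * y f = of_real (norm (y f))" by (rule unimodular_rotation)
  let ?g = "\<lambda>w. a * f w + 0 * f w"
  have "?g \<in> K" using K'(3) f(1) a(1) unfolding abs_convex_def by (metis add.right_neutral norm_zero order_refl)
  moreover have "y ?g = of_real (norm (y f))"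
    using fun_lin_onD[OF dual_lin[OF y], of f f a 0] f(1) K'(2) a(2) by auto
  ultimately show thesis using that[of ?g] sup by (simp only: re_part_of_real norm_ge_zero)
qed

text \<open>Quantitative bipolar theorem. A point of the compact convex set to which Fan's alternative
  is applied is a choice of one element in each of the finitely many compact sets, so that a sum
  of kappa-seminorms becomes a single supremum.\<close>

lemma kappa_approx_convex_combination:
  assumes y: "y \<in> dual" and D: "D \<subseteq> dual"
    and bal: "\<And>a d. d \<in> D \<Longrightarrow> norm a = 1 \<Longrightarrow> (\<lambda>f. a * d f) \<in> D"
    and dom: "\<And>f e. f \<in> X \<Longrightarrow> 0 < e \<Longrightarrow> \<exists>d\<in>D. norm (y f) < norm (d f) + e"
    and F: "finite F" "F \<subseteq> kappa_idx X I q" and e: "0 < e"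
  shows "\<exists>S l. finite S \<and> S \<subseteq> D \<and> (\<forall>d\<in>S. 0 \<le> l d) \<and> sum l S = 1 \<and>
    (\<Sum>K\<in>F. kappa_sn K (\<lambda>f. y f - (\<Sum>d\<in>S. of_real (l d) * d f))) \<le> e"
proof -
  let ?Tp = "product_topology (\<lambda>_. sn_topology X I q) F"
  let ?P = "Pi\<^sub>E F (\<lambda>K. K)"
  \<comment> \<open>The subtracted e turns the slack in \<open>dom\<close> into the strict
    negativity that the compact form of Fan's alternative asks for.\<close>
  define G where "G d k = (\<Sum>K\<in>F. re_part (y (k K) - d (k K))) - e" for d and k :: "('w \<Rightarrow> 'k) set \<Rightarrow> ('w \<Rightarrow> 'k)"
  have K: "K \<noteq> {}" "K \<subseteq> X" "abs_convex (*) K" "compactin (sn_topology X I q) K" if "K \<in> F" for K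
    using F(2) that by (auto simp: kappa_idx_def)
  have diff: "(\<lambda>f. y f - d f) \<in> dual" if "d \<in> dual" for d
    by (rule fun_subspace_diff[OF dual_subspace vector_space_mult y that])
  have kX: "k K \<in> X" if "k \<in> ?P" "K \<in> F" for k K
    using that K(2) by (auto simp: PiE_def Pi_def)
  have comp: "compactin ?Tp ?P" using K(4) by (simp add: compactin_PiE)
  have ne: "?P \<noteq> {}" using K(1) by (simp add: PiE_eq_empty_iff)
  have cont: "continuous_map ?Tp euclideanreal (G d)" if "d \<in> D" for d
    unfolding G_def
  proof (intro continuous_map_diff continuous_map_sum F(1))
    fix K assume "K \<in> F"
    have "continuous_map (sn_topology X I q) euclideanreal (\<lambda>f. re_part (y f - d f))"
      using that D by (intro continuous_map_dual[OF diff])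
        (auto simp: re_part_diff[symmetric] abs_re_part_le)
    from continuous_map_compose[OF continuous_map_product_projection[OF \<open>K \<in> F\<close>] this]
    show "continuous_map ?Tp euclideanreal (\<lambda>k. re_part (y (k K) - d (k K)))"
      by (simp add: o_def)
  qed simp
  have conc: "concavelike D ?P G"
    unfolding concavelike_def
  proof (intro ballI allI impI)
    fix k k' and t :: real assume k: "k \<in> ?P" "k' \<in> ?P" and t: "0 \<le> t \<and> t \<le> 1"
    \<comment> \<open>The convex combination is taken coordinatewise and restricted to F to stay in
      the extensional product; G d is affine along it, so concavity holds with equality.\<close>
    define h where "h = (\<lambda>K\<in>F. \<lambda>w. of_real (1 - t) * k K w + of_real t * k' K w)"
    have "h K \<in> K" if "K \<in> F" for K
    proof -
      have "norm (of_real (1 - t) :: 'k) + norm (of_real t :: 'k) \<le> 1"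
        unfolding norm_of_real using t by simp
      moreover have "k K \<in> K" "k' K \<in> K" using k that by auto
      ultimately show ?thesis using K(3)[OF that] that by (simp add: abs_convex_def h_def)
    qed
    then have "h \<in> ?P" by (auto simp: h_def)
    moreover have "G d h = (1 - t) * G d k + t * G d k'" if "d \<in> D" for d
    proof -
      have "re_part (y (h K) - d (h K))
          = (1 - t) * re_part (y (k K) - d (k K)) + t * re_part (y (k' K) - d (k' K))"
        if "K \<in> F" for K
      proof -
        have "y (h K) - d (h K) = of_real (1 - t) * (y (k K) - d (k K)) + of_real t * (y (k' K) - d (k' K))"
          using fun_lin_onD[OF dual_lin[OF diff], of d "k K" "k' K" "of_real (1 - t)" "of_real t"]
            kX[OF k(1) that] kX[OF k(2) that] \<open>d \<in> D\<close> D that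
          by (simp add: h_def subset_iff)
        then show ?thesis
          using t by (simp only: re_part_add re_part_of_real_mult diff_ge_0_iff_ge)
      qed
      then have "(\<Sum>K\<in>F. re_part (y (h K) - d (h K)))
          = (1 - t) * (\<Sum>K\<in>F. re_part (y (k K) - d (k K))) + t * (\<Sum>K\<in>F. re_part (y (k' K) - d (k' K)))"
        by (simp add: sum.distrib sum_distrib_left)
      then show ?thesis by (simp add: G_def algebra_simps)
    qed
    ultimately show "\<exists>h\<in>?P. \<forall>d\<in>D. (1 - t) * G d k + t * G d k' \<le> G d h" by (metis order_refl)
  qed
  have alt: "\<exists>d\<in>D. G d k < 0" if k: "k \<in> ?P" for k
  proof -
    \<comment> \<open>By linearity the sum over the chosen points is a value at this single element
      of X. There \<open>dom\<close> supplies a functional almost dominating y, and rotating it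
      makes its value real and nonnegative.\<close>
    let ?f = "\<lambda>w. \<Sum>K\<in>F. 1 * k K w"
    have f: "?f \<in> X" by (rule fun_subspace_sum[OF sub]) (rule kX[OF k])
    have sum_eq: "z ?f = (\<Sum>K\<in>F. z (k K))" if "z \<in> dual" for z
      using fun_lin_on_sum[OF sub dual_lin[OF that] vector_space_mult, of F k "\<lambda>_. 1"] kX[OF k] by simp
    obtain d where d: "d \<in> D" "norm (y ?f) < norm (d ?f) + e" using dom[OF f e] by blast
    obtain a where a: "norm a = 1" "a * d ?f = of_real (norm (d ?f))" by (rule unimodular_rotation)
    let ?d = "\<lambda>f. a * d f"
    have ad: "?d \<in> D" by (rule bal[OF d(1) a(1)])
    have "(\<Sum>K\<in>F. re_part (y (k K) - ?d (k K))) = re_part (y ?f - ?d ?f)"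
      using sum_eq[OF diff[of ?d]] ad D by (simp add: re_part_sum[symmetric] subset_iff)
    also have "\<dots> = re_part (y ?f) - norm (d ?f)"
      unfolding a(2) by (simp only: re_part_diff re_part_of_real norm_ge_zero)
    also have "\<dots> < e" using re_part_le_norm[of "y ?f"] d(2) by linarith
    finally show ?thesis using ad by (intro bexI[of _ ?d]) (auto simp: G_def)
  qed
  have "\<exists>S l. finite S \<and> S \<subseteq> D \<and> (\<forall>d\<in>S. 0 \<le> l d) \<and> sum l S = 1 \<and>
      (\<forall>k\<in>?P. (\<Sum>d\<in>S. l d * G d k) \<le> 0)"
    by (rule fan_alternative_compact[OF comp ne _ conc]) (erule cont, erule alt)
  then obtain S l where S: "finite S" "S \<subseteq> D" "\<forall>d\<in>S. 0 \<le> l d" "sum l S = 1"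
    and le: "\<forall>k\<in>?P. (\<Sum>d\<in>S. l d * G d k) \<le> 0"
    by (elim exE conjE) (rule that)
  let ?z = "\<lambda>f. y f - (\<Sum>d\<in>S. of_real (l d) * d f)"
  have z: "?z \<in> dual"
    using S(2) D by (intro diff fun_subspace_sum[OF dual_subspace]) auto
  \<comment> \<open>The points at which the remainder attains its seminorms, one per compact set,
    form the single k at which Fan's inequality is evaluated.\<close>
  have "\<forall>K\<in>F. \<exists>f. f \<in> K \<and> kappa_sn K ?z = re_part (?z f)"
  proof
    fix K assume "K \<in> F"
    obtain f where "f \<in> K" "kappa_sn K ?z = re_part (?z f)"
      by (rule kappa_sn_attained[OF z subsetD[OF F(2) \<open>K \<in> F\<close>]])
    then show "\<exists>f. f \<in> K \<and> kappa_sn K ?z = re_part (?z f)" by (intro exI conjI)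
  qed
  from bchoice[OF this]
  obtain k where k: "\<forall>K\<in>F. k K \<in> K \<and> kappa_sn K ?z = re_part (?z (k K))" by (elim exE)
  let ?k = "restrict k F"
  have kP: "?k \<in> ?P" using k by auto
  \<comment> \<open>As the weights sum to 1, y is its own weighted average, so the remainder is the
    average of the differences y - d.\<close>
  have "re_part (?z (k K)) = (\<Sum>d\<in>S. l d * re_part (y (k K) - d (k K)))" for K
  proof -
    have "(\<Sum>d\<in>S. of_real (l d) :: 'k) = 1" using S(4) by (metis of_real_sum of_real_1)
    then have "?z (k K) = (\<Sum>d\<in>S. of_real (l d) * (y (k K) - d (k K)))"
      by (simp add: right_diff_distrib sum_subtractf sum_distrib_right[symmetric])
    then have "re_part (?z (k K)) = (\<Sum>d\<in>S. re_part (of_real (l d) * (y (k K) - d (k K))))"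
      by (simp only: re_part_sum)
    also have "\<dots> = (\<Sum>d\<in>S. l d * re_part (y (k K) - d (k K)))"
      using S(3) by (intro sum.cong refl re_part_of_real_mult) simp
    finally show ?thesis .
  qed
  then have "(\<Sum>K\<in>F. kappa_sn K ?z) = (\<Sum>K\<in>F. \<Sum>d\<in>S. l d * re_part (y (k K) - d (k K)))"
    using k by simp
  also have "\<dots> = (\<Sum>d\<in>S. l d * (\<Sum>K\<in>F. re_part (y (k K) - d (k K))))"
    unfolding sum_distrib_left by (rule sum.swap)
  also have "\<dots> = (\<Sum>d\<in>S. l d * (G d ?k + e))" by (simp add: G_def)
  also have "\<dots> = (\<Sum>d\<in>S. l d * G d ?k) + e"
    using S(4) by (simp add: distrib_left sum.distrib sum_distrib_right[symmetric])
  also have "\<dots> \<le> e" using bspec[OF le kP] by simp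
  finally show ?thesis using S by (intro exI[of _ S] exI[of _ l] conjI)
qed

lemma eps_product_lin: "u \<in> eps_product X I q sc A p \<Longrightarrow> fun_lin_on (*) dual sc u"
  by (simp add: eps_product_def)

lemma eps_product_bound:
  assumes "u \<in> eps_product X I q sc A p" "\<alpha> \<in> A"
  obtains F C where "finite F" "F \<subseteq> kappa_idx X I q" "0 \<le> C"
    "\<And>y. y \<in> dual \<Longrightarrow> p \<alpha> (u y) \<le> C * (\<Sum>K\<in>F. kappa_sn K y)"
proof -
  obtain F C where F: "finite F" "F \<subseteq> kappa_idx X I q"
    and C: "\<And>y. y \<in> dual \<Longrightarrow> p \<alpha> (u y) \<le> C * (\<Sum>K\<in>F. kappa_sn K y)"
  proof -
    have "\<forall>\<beta>\<in>A. \<exists>F C. finite F \<and> F \<subseteq> kappa_idx X I q \<and>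
        (\<forall>y\<in>dual. p \<beta> (u y) \<le> C * (\<Sum>K\<in>F. kappa_sn K y))"
      using assms(1) by (simp add: eps_product_def sn_cont_def)
    from bspec[OF this assms(2)] show thesis by (auto intro: that)
  qed
  have "p \<alpha> (u y) \<le> \<bar>C\<bar> * (\<Sum>K\<in>F. kappa_sn K y)" if "y \<in> dual" for y
  proof -
    have "0 \<le> kappa_sn K y" if "K \<in> F" for K
      using kappa_sn_attained[OF \<open>y \<in> dual\<close>] F(2) that by (meson subsetD)
    then have "C * (\<Sum>K\<in>F. kappa_sn K y) \<le> \<bar>C\<bar> * (\<Sum>K\<in>F. kappa_sn K y)"
      by (intro mult_right_mono sum_nonneg) auto
    then show ?thesis using C[OF that] by linarith
  qed
  then show thesis by (rule that[OF F abs_ge_zero])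
qed

text \<open>\<open>dom\<close> says that y lies in the bipolar of D: its modulus at f is at most the
  supremum over D, written with a slack e. A bound for p composed with u on D passes to convex
  combinations by convexity, and from them to y because u is kappa-continuous.\<close>

lemma eps_product_bipolar_bound:
  assumes E: "lc_hausdorff sc A p" and u: "u \<in> eps_product X I q sc A p" and \<alpha>: "\<alpha> \<in> A"
    and y: "y \<in> dual" and D: "D \<subseteq> dual"
    and bal: "\<And>a d. d \<in> D \<Longrightarrow> norm a = 1 \<Longrightarrow> (\<lambda>f. a * d f) \<in> D"
    and dom: "\<And>f e. f \<in> X \<Longrightarrow> 0 < e \<Longrightarrow> \<exists>d\<in>D. norm (y f) < norm (d f) + e"
    and t: "\<And>d. d \<in> D \<Longrightarrow> p \<alpha> (u d) \<le> t"
  shows "p \<alpha> (u y) \<le> t"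
proof (rule field_le_epsilon)
  fix e :: real assume e: "0 < e"
  have vs: "Vector_Spaces.vector_space sc" and sn: "is_seminorm sc (p \<alpha>)"
    using E \<alpha> by (auto simp: lc_hausdorff_def)
  obtain F C where F: "finite F" "F \<subseteq> kappa_idx X I q" "0 \<le> C"
    "\<And>y. y \<in> dual \<Longrightarrow> p \<alpha> (u y) \<le> C * (\<Sum>K\<in>F. kappa_sn K y)"
    using eps_product_bound[OF u \<alpha>] by metis
  \<comment> \<open>The approximation error is amplified by C; C + 1 is used because C may be
    0.\<close>
  have e': "0 < e / (C + 1)" using e F(3) by simp
  have "\<exists>S l. finite S \<and> S \<subseteq> D \<and> (\<forall>d\<in>S. 0 \<le> l d) \<and> sum l S = 1 \<and>
      (\<Sum>K\<in>F. kappa_sn K (\<lambda>f. y f - (\<Sum>d\<in>S. of_real (l d) * d f))) \<le> e / (C + 1)"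
    by (rule kappa_approx_convex_combination[OF y D _ _ F(1,2) e']) (erule (1) bal, erule (1) dom)
  then obtain S l where S: "finite S" "S \<subseteq> D" "\<forall>d\<in>S. 0 \<le> l d" "sum l S = 1"
    "(\<Sum>K\<in>F. kappa_sn K (\<lambda>f. y f - (\<Sum>d\<in>S. of_real (l d) * d f))) \<le> e / (C + 1)"
    by (elim exE conjE) (rule that)
  let ?v = "\<lambda>f. \<Sum>d\<in>S. of_real (l d) * d f"
  let ?z = "\<lambda>f. y f - ?v f"
  have SD: "\<And>d. d \<in> S \<Longrightarrow> d \<in> dual" using S(2) D by auto
  have v: "?v \<in> dual" by (rule fun_subspace_sum[OF dual_subspace]) (rule SD)
  have z: "?z \<in> dual" by (rule fun_subspace_diff[OF dual_subspace vector_space_mult y v])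
  have "u ?v = (\<Sum>d\<in>S. sc (of_real (l d)) (u d))"
    by (rule fun_lin_on_sum[OF dual_subspace eps_product_lin[OF u] vs]) (rule SD)
  then have "p \<alpha> (u ?v) \<le> (\<Sum>d\<in>S. norm (of_real (l d) :: 'k) * p \<alpha> (u d))"
    by (simp only: is_seminorm_sum_le[OF sn vs])
  also have "\<dots> \<le> (\<Sum>d\<in>S. l d * t)"
    using S(2,3) t by (intro sum_mono mult_mono) (auto simp: is_seminormD(1)[OF sn])
  also have "\<dots> = t" using S(4) by (simp add: sum_distrib_right[symmetric])
  finally have uv: "p \<alpha> (u ?v) \<le> t" .
  have "p \<alpha> (u ?z) \<le> C * (e / (C + 1))"
    using F(4)[OF z] mult_left_mono[OF S(5) F(3)] by linarith
  also have "\<dots> \<le> e" using e F(3) by (simp add: field_simps)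
  finally have uz: "p \<alpha> (u ?z) \<le> e" .
  have "u ?z = u y - u ?v"
    by (rule fun_lin_on_diff[OF eps_product_lin[OF u] vector_space_mult vs y v])
  then have "p \<alpha> (u y) \<le> p \<alpha> (u ?v) + p \<alpha> (u ?z)"
    using is_seminormD(3)[OF sn, of "u ?v" "u ?z"] by simp
  then show "p \<alpha> (u y) \<le> t + e" using uv uz by linarith
qed

end

section \<open>Weighted function spaces\<close>

text \<open>Serves both function spaces: the scalar one is the instance with field multiplication,
  the index set \<open>{()}\<close> and the norm.\<close>

context
  fixes sc :: "'k::real_normed_field \<Rightarrow> 'e::ab_group_add \<Rightarrow> 'e"
    and A :: "'a set" and p :: "'a \<Rightarrow> 'e \<Rightarrow> real"
    and om :: "'m \<Rightarrow> 'x set" and nu :: "'j \<Rightarrow> 'm \<Rightarrow> 'x \<Rightarrow> real"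
    and AP :: "('w \<Rightarrow> 'e) set" and domT :: "'m \<Rightarrow> ('w \<Rightarrow> 'e) set"
    and T :: "'m \<Rightarrow> ('w \<Rightarrow> 'e) \<Rightarrow> 'x \<Rightarrow> 'e"
  assumes vs: "Vector_Spaces.vector_space sc"
    and sn: "\<And>\<alpha>. \<alpha> \<in> A \<Longrightarrow> is_seminorm sc (p \<alpha>)"
    and weights: "weight_system om nu"
    and data: "FV_data sc AP domT T"
begin

lemma FV_op_lin:
  assumes "f \<in> domT m" "g \<in> domT m"
  shows "T m (\<lambda>w. sc a (f w) + sc b (g w)) x = sc a (T m f x) + sc b (T m g x)"
  using data assms by (simp add: FV_data_def)

lemma FV_op_zero: "T m (\<lambda>_. 0) x = 0"
proof -
  interpret vector_space sc by (rule vs)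
  have "(\<lambda>_. 0) \<in> domT m" using data by (simp add: FV_data_def fun_subspace_def)
  then show ?thesis using FV_op_lin[of "\<lambda>_. 0" m "\<lambda>_. 0" 0 0 x] by simp
qed

lemma FV_dom: "f \<in> FV A p AP domT T om nu \<Longrightarrow> f \<in> domT m"
  by (simp add: FV_def)

lemma FV_bdd:
  "f \<in> FV A p AP domT T om nu \<Longrightarrow> \<alpha> \<in> A \<Longrightarrow>
    bdd_above ((\<lambda>x. p \<alpha> (T m f x) * nu j m x) ` om m)"
  by (simp add: FV_def)

lemma FV_sn_upper:
  assumes "f \<in> FV A p AP domT T om nu" "\<alpha> \<in> A" "x \<in> om m"
  shows "p \<alpha> (T m f x) * nu j m x \<le> FV_sn p T om nu (j, m, \<alpha>) f"
  unfolding FV_sn_def using FV_bdd[OF assms(1,2)] assms(3) by (auto intro: cSUP_upper)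

lemma FV_sn_least:
  assumes "\<And>x. x \<in> om m \<Longrightarrow> p \<alpha> (T m f x) * nu j m x \<le> c"
  shows "FV_sn p T om nu (j, m, \<alpha>) f \<le> c"
proof -
  have "om m \<noteq> {}" using weights by (simp add: weight_system_def)
  then show ?thesis unfolding FV_sn_def using assms by (auto intro: cSUP_least)
qed

lemma FV_sn_approx:
  assumes "0 < e"
  obtains x where "x \<in> om m" "FV_sn p T om nu (j, m, \<alpha>) f < p \<alpha> (T m f x) * nu j m x + e"
proof (rule ccontr)
  assume "\<not> thesis"
  then have "FV_sn p T om nu (j, m, \<alpha>) f \<le> FV_sn p T om nu (j, m, \<alpha>) f - e"
    using that by (intro FV_sn_least) (force simp: not_less)
  then show False using assms by simp
qed

lemma FV_term_nonneg:
  assumes "\<alpha> \<in> A" "x \<in> om m"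
  shows "0 \<le> p \<alpha> z * nu j m x"
  using assms weights is_seminormD(1)[OF sn] by (simp add: weight_system_def)

lemma FV_sn_nonneg:
  assumes "f \<in> FV A p AP domT T om nu" "i \<in> FV_idx A"
  shows "0 \<le> FV_sn p T om nu i f"
proof -
  obtain j m \<alpha> where i: "i = (j, m, \<alpha>)" "\<alpha> \<in> A" using assms(2) by (auto simp: FV_idx_def)
  have "om m \<noteq> {}" using weights by (simp add: weight_system_def)
  then obtain x where "x \<in> om m" by blast
  then show ?thesis
    using FV_term_nonneg[OF i(2)] FV_sn_upper[OF assms(1) i(2)] unfolding i(1)
    by (meson order_trans)
qed

lemma FV_sn_zero: "\<alpha> \<in> A \<Longrightarrow> FV_sn p T om nu (j, m, \<alpha>) (\<lambda>_. 0) = 0"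
proof -
  assume "\<alpha> \<in> A"
  have "om m \<noteq> {}" using weights by (simp add: weight_system_def)
  then show ?thesis
    by (simp add: FV_sn_def FV_op_zero is_seminorm_zero[OF sn[OF \<open>\<alpha> \<in> A\<close>] vs])
qed

lemma FV_term_triangle:
  assumes "\<alpha> \<in> A" "x \<in> om m" "f \<in> domT m" "g \<in> domT m"
  shows "p \<alpha> (T m (\<lambda>w. sc a (f w) + sc b (g w)) x) * nu j m x
    \<le> norm a * (p \<alpha> (T m f x) * nu j m x) + norm b * (p \<alpha> (T m g x) * nu j m x)"
proof -
  have "p \<alpha> (T m (\<lambda>w. sc a (f w) + sc b (g w)) x) \<le> norm a * p \<alpha> (T m f x) + norm b * p \<alpha> (T m g x)"
    using is_seminormD(3)[OF sn[OF assms(1)], of "sc a (T m f x)" "sc b (T m g x)"]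
    by (simp add: FV_op_lin[OF assms(3,4)] is_seminormD(2)[OF sn[OF assms(1)]])
  moreover have "0 \<le> nu j m x" using weights assms(2) by (simp add: weight_system_def)
  ultimately have "p \<alpha> (T m (\<lambda>w. sc a (f w) + sc b (g w)) x) * nu j m x
      \<le> (norm a * p \<alpha> (T m f x) + norm b * p \<alpha> (T m g x)) * nu j m x"
    by (rule mult_right_mono)
  then show ?thesis by (simp add: algebra_simps)
qed

text \<open>A pointwise bound, because it must come before the membership of the combination in
  \<open>FV\<close>: it yields the finiteness of its suprema as well as the triangle inequality for
  them.\<close>

lemma FV_term_triangle_sn:
  assumes "\<alpha> \<in> A" "x \<in> om m" and f: "f \<in> FV A p AP domT T om nu" and g: "g \<in> FV A p AP domT T om nu"
  shows "p \<alpha> (T m (\<lambda>w. sc a (f w) + sc b (g w)) x) * nu j m x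
    \<le> norm a * FV_sn p T om nu (j, m, \<alpha>) f + norm b * FV_sn p T om nu (j, m, \<alpha>) g"
proof -
  have "norm a * (p \<alpha> (T m f x) * nu j m x) \<le> norm a * FV_sn p T om nu (j, m, \<alpha>) f"
    "norm b * (p \<alpha> (T m g x) * nu j m x) \<le> norm b * FV_sn p T om nu (j, m, \<alpha>) g"
    using FV_sn_upper[OF f assms(1,2)] FV_sn_upper[OF g assms(1,2)] by (auto intro!: mult_left_mono)
  then show ?thesis
    using FV_term_triangle[OF assms(1,2) FV_dom[OF f] FV_dom[OF g], of a b j] by linarith
qed

lemma FV_sn_triangle:
  assumes "\<alpha> \<in> A" "f \<in> FV A p AP domT T om nu" "g \<in> FV A p AP domT T om nu"
  shows "FV_sn p T om nu (j, m, \<alpha>) (\<lambda>w. sc a (f w) + sc b (g w))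
    \<le> norm a * FV_sn p T om nu (j, m, \<alpha>) f + norm b * FV_sn p T om nu (j, m, \<alpha>) g"
  by (rule FV_sn_least) (rule FV_term_triangle_sn[OF assms(1) _ assms(2,3)])

lemma FV_subspace: "fun_subspace sc (FV A p AP domT T om nu)"
  unfolding fun_subspace_def
proof (intro conjI ballI allI)
  show "(\<lambda>_. 0) \<in> FV A p AP domT T om nu"
    using data by (auto simp: FV_def FV_data_def fun_subspace_def FV_op_zero is_seminorm_zero[OF sn vs])
next
  fix f g a b assume f: "f \<in> FV A p AP domT T om nu" and g: "g \<in> FV A p AP domT T om nu"
  have "bdd_above ((\<lambda>x. p \<alpha> (T m (\<lambda>w. sc a (f w) + sc b (g w)) x) * nu j m x) ` om m)"
    if "\<alpha> \<in> A" for \<alpha> j m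
    by (rule bdd_aboveI2) (rule FV_term_triangle_sn[OF that _ f g])
  moreover have "(\<lambda>w. sc a (f w) + sc b (g w)) \<in> AP"
    using f g data by (intro fun_subspaceD) (auto simp: FV_def FV_data_def)
  moreover have "(\<lambda>w. sc a (f w) + sc b (g w)) \<in> domT m" for m
    using FV_dom[OF f] FV_dom[OF g] data by (intro fun_subspaceD) (auto simp: FV_data_def)
  ultimately show "(\<lambda>w. sc a (f w) + sc b (g w)) \<in> FV A p AP domT T om nu" by (simp add: FV_def)
qed

text \<open>Makes each weighted seminorm continuous for the topology it helps to define, hence
  bounded on compact sets.\<close>

lemma FV_sn_diff_le:
  assumes i: "i \<in> FV_idx A" and f: "f \<in> FV A p AP domT T om nu" and g: "g \<in> FV A p AP domT T om nu"
  shows "\<bar>FV_sn p T om nu i g - FV_sn p T om nu i f\<bar> \<le> FV_sn p T om nu i (\<lambda>w. g w - f w)"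
proof -
  interpret vector_space sc by (rule vs)
  obtain j m \<alpha> where i: "i = (j, m, \<alpha>)" "\<alpha> \<in> A" using i by (auto simp: FV_idx_def)
  have d: "(\<lambda>w. g w - f w) \<in> FV A p AP domT T om nu" by (rule fun_subspace_diff[OF FV_subspace vs g f])
  show ?thesis
    using FV_sn_triangle[OF i(2) f d, of j m 1 1] FV_sn_triangle[OF i(2) g d, of j m 1 "-1"]
    unfolding i(1) by simp
qed

end

text \<open>Reduces an equicontinuity bound to a single index (j, m), so that one family of weighted
  evaluations dominates the whole set.\<close>

lemma directed_sum_bound:
  assumes dir: "hausdorff_directed X I q" and I: "I \<noteq> {}"
    and nonneg: "\<And>i f. i \<in> I \<Longrightarrow> f \<in> X \<Longrightarrow> 0 \<le> q i f"
    and "finite F" "F \<subseteq> I"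
  shows "\<exists>i\<in>I. \<exists>C\<ge>0. \<forall>f\<in>X. (\<Sum>i\<in>F. q i f) \<le> C * q i f"
  using assms(4,5)
proof (induction F)
  case empty
  obtain i where "i \<in> I" using I by blast
  then show ?case by (intro bexI[of _ i] exI[of _ 0]) auto
next
  case (insert j F)
  then obtain i C where i: "i \<in> I" "0 \<le> C" "\<And>f. f \<in> X \<Longrightarrow> (\<Sum>i\<in>F. q i f) \<le> C * q i f" by auto
  have "\<forall>i1\<in>I. \<forall>i2\<in>I. \<exists>i3\<in>I. \<exists>C. \<forall>f\<in>X. max (q i1 f) (q i2 f) \<le> C * q i3 f"
    using dir by (simp add: hausdorff_directed_def)
  then obtain k C' where k: "k \<in> I" "\<And>f. f \<in> X \<Longrightarrow> max (q i f) (q j f) \<le> C' * q k f"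
    using i(1) insert.prems by (meson insert_subset)
  have "(\<Sum>i\<in>insert j F. q i f) \<le> ((C + 1) * \<bar>C'\<bar>) * q k f" if f: "f \<in> X" for f
  proof -
    have "C' * q k f \<le> \<bar>C'\<bar> * q k f" using nonneg[OF k(1) f] by (intro mult_right_mono) auto
    then have le: "q i f \<le> \<bar>C'\<bar> * q k f" "q j f \<le> \<bar>C'\<bar> * q k f" using k(2)[OF f] by auto
    have "C * q i f \<le> C * (\<bar>C'\<bar> * q k f)" using le(1) i(2) by (rule mult_left_mono)
    then show ?thesis using i(3)[OF f] le(2) insert.hyps by (simp add: algebra_simps)
  qed
  moreover have "0 \<le> (C + 1) * \<bar>C'\<bar>" using i(2) by simp
  ultimately show ?case using k(1) by blast
qed

section \<open>The epsilon-product and the embedding S\<close>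

lemma is_seminorm_norm: "is_seminorm (*) (norm :: 'k::real_normed_field \<Rightarrow> real)"
  by (simp add: is_seminorm_def norm_mult norm_triangle_ineq)

lemma eps_product_diff:
  assumes X: "seminormed_fun_space X I q" and E: "lc_hausdorff sc A p"
    and u: "u \<in> eps_product X I q sc A p" and v: "v \<in> eps_product X I q sc A p"
  shows "(\<lambda>y. u y - v y) \<in> eps_product X I q sc A p"
proof -
  interpret seminormed_fun_space X I q by fact
  interpret vector_space sc using E by (simp add: lc_hausdorff_def)
  have "fun_lin_on (*) dual sc (\<lambda>y. u y - v y)"
    using eps_product_lin[OF u] eps_product_lin[OF v]
    by (simp add: fun_lin_on_def scale_right_diff_distrib algebra_simps)
  moreover have "u y - v y = 0" if "y \<notin> dual" for y
    using u v that by (simp add: eps_product_def)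
  moreover have "\<exists>F C. finite F \<and> F \<subseteq> kappa_idx X I q \<and>
      (\<forall>y\<in>dual. p \<alpha> (u y - v y) \<le> C * (\<Sum>K\<in>F. kappa_sn K y))" if \<alpha>: "\<alpha> \<in> A" for \<alpha>
  proof -
    obtain F C where F: "finite F" "F \<subseteq> kappa_idx X I q" "0 \<le> C"
      "\<And>y. y \<in> dual \<Longrightarrow> p \<alpha> (u y) \<le> C * (\<Sum>K\<in>F. kappa_sn K y)"
      using eps_product_bound[OF u \<alpha>] by metis
    obtain F' C' where F': "finite F'" "F' \<subseteq> kappa_idx X I q" "0 \<le> C'"
      "\<And>y. y \<in> dual \<Longrightarrow> p \<alpha> (v y) \<le> C' * (\<Sum>K\<in>F'. kappa_sn K y)"
      using eps_product_bound[OF v \<alpha>] by metis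
    have sn: "is_seminorm sc (p \<alpha>)" using E \<alpha> by (simp add: lc_hausdorff_def)
    have "p \<alpha> (u y - v y) \<le> (C + C') * (\<Sum>K\<in>F\<union>F'. kappa_sn K y)" if y: "y \<in> dual" for y
    proof -
      have pos: "0 \<le> kappa_sn K y" if "K \<in> F \<union> F'" for K
        using kappa_sn_attained[OF y, of K] F(2) F'(2) that by blast
      have S: "(\<Sum>K\<in>F. kappa_sn K y) \<le> (\<Sum>K\<in>F\<union>F'. kappa_sn K y)"
        "(\<Sum>K\<in>F'. kappa_sn K y) \<le> (\<Sum>K\<in>F\<union>F'. kappa_sn K y)"
        using F(1) F'(1) pos by (auto intro!: sum_mono2)
      have "p \<alpha> (u y - v y) \<le> p \<alpha> (u y) + p \<alpha> (v y)"
        using is_seminormD(3)[OF sn, of "u y" "sc (-1) (v y)"] is_seminormD(2)[OF sn, of "-1" "v y"]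
        by simp
      also have "\<dots> \<le> C * (\<Sum>K\<in>F\<union>F'. kappa_sn K y) + C' * (\<Sum>K\<in>F\<union>F'. kappa_sn K y)"
        using F(4)[OF y] F'(4)[OF y] mult_left_mono[OF S(1) F(3)] mult_left_mono[OF S(2) F'(3)]
        by linarith
      finally show ?thesis by (simp add: algebra_simps)
    qed
    then show ?thesis using F F' by (intro exI[of _ "F \<union> F'"] exI[of _ "C + C'"]) simp
  qed
  ultimately show ?thesis by (simp add: eps_product_def sn_cont_def)
qed

text \<open>Continuity of the inverse on the range is expressed on the domain: the seminorms of S u
  are pulled back to the epsilon-product, and the identity is continuous from them to its own
  seminorms.\<close>

theorem theorem3p9:
  fixes sc :: "'k::real_normed_field \<Rightarrow> 'e::ab_group_add \<Rightarrow> 'e"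
    and A :: "'a set" and p :: "'a \<Rightarrow> 'e \<Rightarrow> real"
    and om :: "'m \<Rightarrow> 'x set" and nu :: "'j \<Rightarrow> 'm \<Rightarrow> 'x \<Rightarrow> real"
    and APK :: "('w \<Rightarrow> 'k) set" and domK :: "'m \<Rightarrow> ('w \<Rightarrow> 'k) set"
    and TK :: "'m \<Rightarrow> ('w \<Rightarrow> 'k) \<Rightarrow> 'x \<Rightarrow> 'k"
    and APE :: "('w \<Rightarrow> 'e) set" and domE :: "'m \<Rightarrow> ('w \<Rightarrow> 'e) set"
    and TE :: "'m \<Rightarrow> ('w \<Rightarrow> 'e) \<Rightarrow> 'x \<Rightarrow> 'e"
  defines "XK \<equiv> FV {()} (\<lambda>_. norm) APK domK TK om nu"
    and "IK \<equiv> FV_idx {()} :: ('j \<times> 'm \<times> unit) set"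
    and "qK \<equiv> FV_sn (\<lambda>_. norm) TK om nu"
    and "XE \<equiv> FV A p APE domE TE om nu"
    and "IE \<equiv> FV_idx A :: ('j \<times> 'm \<times> 'a) set"
    and "qE \<equiv> FV_sn p TE om nu"
  assumes E: "lc_hausdorff sc A p"
    and nontrivial: "\<exists>e::'e. e \<noteq> 0"
    and weights: "weight_system om nu"
    and gen: "generator sc A p om nu APK domK TK APE domE TE"
    and cons: "consistent sc A p om nu APK domK TK APE domE TE"
  shows "(\<forall>u\<in>eps_product XK IK qK sc A p. S_map XK u \<in> XE)
    \<and> inj_on (S_map XK) (eps_product XK IK qK sc A p)
    \<and> sn_cont (eps_product XK IK qK sc A p) (eps_idx XK IK qK A) (eps_sn p) IE qE (S_map XK)
    \<and> sn_cont (eps_product XK IK qK sc A p) IE (\<lambda>i u. qE i (S_map XK u)) (eps_idx XK IK qK A) (eps_sn p) id"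
proof -
  let ?eps = "eps_product XK IK qK sc A p"
  have vs: "Vector_Spaces.vector_space sc" and sn: "\<And>\<alpha>. \<alpha> \<in> A \<Longrightarrow> is_seminorm sc (p \<alpha>)"
    using E by (auto simp: lc_hausdorff_def)
  have dataK: "FV_data (*) APK domK TK" and dataE: "FV_data sc APE domE TE"
    and dirK: "hausdorff_directed XK IK qK"
    using gen by (auto simp: generator_def Let_def XK_def IK_def qK_def)
  note snK = is_seminorm_norm
  have subK: "fun_subspace (*) XK"
    unfolding XK_def by (rule FV_subspace[OF vector_space_mult snK weights dataK])
  have nonnegK: "0 \<le> qK i f" if "i \<in> IK" "f \<in> XK" for i f
    using that unfolding XK_def IK_def qK_def
    by (intro FV_sn_nonneg[OF vector_space_mult snK weights dataK])
  interpret seminormed_fun_space XK IK qK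
    by unfold_locales (rule subK, rule nonnegK)
  \<comment> \<open>The value 0 outside \<open>XK\<close> is the normalisation required in
    \<open>sn_dual\<close>, and the expression is the one that \<open>consistent\<close> feeds to
    u.\<close>
  define ev where "ev m x = (\<lambda>f. if f \<in> XK then TK m f x else 0)" for m x
  have ev_le: "norm (ev m x f) * nu j m x \<le> qK (j, m, ()) f" if "x \<in> om m" "f \<in> XK" for j m x f
    using FV_sn_upper[OF vector_space_mult snK weights dataK, of f "{()}" "()" x m j] that
    by (simp add: ev_def qK_def XK_def)
  have nu0: "0 \<le> nu j m x" if "x \<in> om m" for j m x
    using weights that by (simp add: weight_system_def)
  have idx: "(j, m, ()) \<in> IK" for j m by (simp add: IK_def FV_idx_def)
  have ev_dual: "ev m x \<in> dual" if x: "x \<in> om m" for m x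
  proof -
    have "\<exists>j. 0 < nu j m x" using weights x by (simp add: weight_system_def)
    then obtain j where j: "0 < nu j m x" by blast
    show ?thesis
    \<comment> \<open>Some weight is positive at x; dividing by it bounds the unweighted evaluation
      by one seminorm.\<close>
    proof (rule dualI[of _ "{(j, m, ())}" "1 / nu j m x"])
      show "fun_lin_on (*) XK (*) (ev m x)"
        unfolding fun_lin_on_def
      proof (intro ballI allI)
        fix f g a b assume f: "f \<in> XK" and g: "g \<in> XK"
        have "(\<lambda>w. a * f w + b * g w) \<in> XK" by (rule fun_subspaceD[OF subK f g])
        moreover have "f \<in> domK m" "g \<in> domK m" using f g unfolding XK_def by (auto simp: FV_def)
        ultimately show "ev m x (\<lambda>w. a * f w + b * g w) = a * ev m x f + b * ev m x g"
          using f g FV_op_lin[OF vector_space_mult snK weights dataK, of f m g a b x]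
          by (simp add: ev_def)
      qed
      fix f assume "f \<in> XK"
      then show "norm (ev m x f) \<le> 1 / nu j m x * (\<Sum>i\<in>{(j, m, ())}. qK i f)"
        using ev_le[OF x, of f j] j by (simp add: pos_le_divide_eq)
    qed (auto simp: ev_def idx)
  qed
  have wev_dual: "(\<lambda>f. a * ev m x f) \<in> dual" if "x \<in> om m" for a m x
    using fun_subspaceD[OF dual_subspace ev_dual ev_dual, OF that that, of a 0] by simp
  have u_wev: "u (\<lambda>f. a * ev m x f) = sc a (u (ev m x))" if "u \<in> ?eps" "x \<in> om m" for u a m x
  proof -
    interpret vector_space sc by (rule vs)
    show ?thesis
      using fun_lin_onD[OF eps_product_lin[OF that(1)] ev_dual ev_dual, OF that(2,2), of a 0] by simp
  qed
  have cons': "\<forall>u\<in>?eps. \<forall>m. \<forall>x\<in>om m. S_map XK u \<in> APE \<and> S_map XK u \<in> domE m \<and>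
      TE m (S_map XK u) x = u (ev m x)"
    using cons unfolding consistent_def Let_def ev_def XK_def IK_def qK_def .
  have S: "S_map XK u \<in> APE" "S_map XK u \<in> domE m" "x \<in> om m \<Longrightarrow> TE m (S_map XK u) x = u (ev m x)"
    if "u \<in> ?eps" for u m x
  proof -
    note c = bspec[OF spec[OF bspec[OF cons' that], of m]]
    show "x \<in> om m \<Longrightarrow> TE m (S_map XK u) x = u (ev m x)" using c by simp
    \<comment> \<open>\<open>consistent\<close> yields the memberships only together with a point of
      \<open>om m\<close>, so one has to be produced.\<close>
    have "om m \<noteq> {}" using weights by (simp add: weight_system_def)
    then obtain x' where "x' \<in> om m" by blast
    from c[OF this] show "S_map XK u \<in> APE" "S_map XK u \<in> domE m" by simp_all
  qed
  have term_eq: "p \<alpha> (TE m (S_map XK u) x) * nu j m x = p \<alpha> (u (\<lambda>f. of_real (nu j m x) * ev m x f))"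
    if "u \<in> ?eps" "x \<in> om m" "\<alpha> \<in> A" for u m x j \<alpha>
    using nu0[OF that(2)] by (simp add: S(3)[OF that(1,2)] u_wev[OF that(1,2)] is_seminormD(2)[OF sn[OF that(3)]])
  \<comment> \<open>The functionals nu j m x times ev m x are dominated by the seminorm with index
    (j, m), whatever x is. That seminorm is bounded on each compact set controlling u, which gives a
    bound uniform in x.\<close>
  have term_bdd: "bdd_above ((\<lambda>x. p \<alpha> (TE m (S_map XK u) x) * nu j m x) ` om m)"
    if u: "u \<in> ?eps" and \<alpha>: "\<alpha> \<in> A" for u j m \<alpha>
  proof -
    obtain F C where F: "finite F" "F \<subseteq> kappa_idx XK IK qK" "0 \<le> C"
      "\<And>y. y \<in> dual \<Longrightarrow> p \<alpha> (u y) \<le> C * (\<Sum>K\<in>F. kappa_sn K y)"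
      using eps_product_bound[OF u \<alpha>] by metis
    have "\<exists>B. \<forall>f\<in>K. qK (j, m, ()) f \<le> B" if "K \<in> F" for K
    proof -
      have "compactin (sn_topology XK IK qK) K" using F(2) that by (auto simp: kappa_idx_def)
      moreover have "continuous_map (sn_topology XK IK qK) euclideanreal (qK (j, m, ()))"
      proof (rule continuous_map_sn_topology[of "{(j, m, ())}" _ 1])
        fix f g assume "f \<in> XK" "g \<in> XK"
        then show "\<bar>qK (j, m, ()) g - qK (j, m, ()) f\<bar> \<le> 1 * (\<Sum>i\<in>{(j, m, ())}. qK i (\<lambda>w. g w - f w))"
          using FV_sn_diff_le[OF vector_space_mult snK weights dataK, of "(j, m, ())" "{()}" f g] idx[of j m]
          by (simp add: qK_def XK_def IK_def)
      qed (auto simp: idx)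
      ultimately have "compactin euclideanreal (qK (j, m, ()) ` K)" by (rule image_compactin)
      then have "bdd_above (qK (j, m, ()) ` K)"
        by (simp add: bounded_imp_bdd_above compact_imp_bounded)
      then show ?thesis by (auto simp: bdd_above_def)
    qed
    then have "\<exists>B. \<forall>K\<in>F. \<forall>f\<in>K. qK (j, m, ()) f \<le> B K" by (intro bchoice) simp
    then obtain B where B: "\<And>K f. K \<in> F \<Longrightarrow> f \<in> K \<Longrightarrow> qK (j, m, ()) f \<le> B K" by auto
    show ?thesis
    proof (rule bdd_aboveI2)
      fix x assume x: "x \<in> om m"
      let ?y = "\<lambda>f. of_real (nu j m x) * ev m x f"
      have "kappa_sn K ?y \<le> B K" if "K \<in> F" for K
      proof -
        have K: "K \<noteq> {}" "K \<subseteq> XK" using F(2) that by (auto simp: kappa_idx_def)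
        have "norm (?y f) \<le> B K" if "f \<in> K" for f
        proof -
          have "norm (?y f) = norm (ev m x f) * nu j m x" using nu0[OF x] by (simp add: norm_mult)
          also have "\<dots> \<le> qK (j, m, ()) f" using K(2) that by (intro ev_le x) auto
          also have "\<dots> \<le> B K" by (rule B[OF \<open>K \<in> F\<close> that])
          finally show ?thesis .
        qed
        then show ?thesis unfolding kappa_sn_def using K(1) by (intro cSUP_least)
      qed
      then have "C * (\<Sum>K\<in>F. kappa_sn K ?y) \<le> C * (\<Sum>K\<in>F. B K)"
        using F(3) by (intro mult_left_mono sum_mono)
      then show "p \<alpha> (TE m (S_map XK u) x) * nu j m x \<le> C * (\<Sum>K\<in>F. B K)"
        using F(4)[OF wev_dual[OF x, of "of_real (nu j m x)"]] term_eq[OF u x \<alpha>] by simp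
    qed
  qed
  have SX: "S_map XK u \<in> XE" if "u \<in> ?eps" for u
    using S(1,2)[OF that] term_bdd[OF that] by (simp add: XE_def FV_def)
  \<comment> \<open>The index and the constant depend only on H and \<alpha>, not on u or y. This
    uniformity gives the continuity of the inverse; for singletons H it gives injectivity.\<close>
  have inverse_bound: "\<exists>i C. i \<in> IE \<and> snd (snd i) = \<alpha> \<and> 0 \<le> C \<and>
      (\<forall>u\<in>?eps. \<forall>y\<in>H. p \<alpha> (u y) \<le> C * qE i (S_map XK u))"
    if H: "equicont XK IK qK H" and \<alpha>: "\<alpha> \<in> A" for H \<alpha>
  proof -
    from H obtain F C where F: "finite F" "F \<subseteq> IK"
      and C: "\<forall>y\<in>H. \<forall>f\<in>XK. norm (y f) \<le> C * (\<Sum>i\<in>F. qK i f)"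
      unfolding equicont_def by (elim exE conjE) (rule that)
    have "IK \<noteq> {}" using idx by blast
    have "\<exists>i\<in>IK. \<exists>C'\<ge>0. \<forall>f\<in>XK. (\<Sum>i\<in>F. qK i f) \<le> C' * qK i f"
      by (rule directed_sum_bound[OF dirK \<open>IK \<noteq> {}\<close> _ F]) (erule (1) nonnegK)
    then obtain i C' where i: "i \<in> IK" "0 \<le> C'" "\<forall>f\<in>XK. (\<Sum>i\<in>F. qK i f) \<le> C' * qK i f"
      by (elim exE conjE bexE) (rule that)
    obtain j m where jm: "i = (j, m, ())" by (cases i) auto
    define c where "c = \<bar>C\<bar> * C'"
    have c0: "0 \<le> c" using i(2) by (simp add: c_def)
    have y_le: "norm (y f) \<le> c * qK (j, m, ()) f" if "y \<in> H" "f \<in> XK" for y f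
    proof -
      have "0 \<le> (\<Sum>i\<in>F. qK i f)" using F(2) that(2) nonnegK by (intro sum_nonneg) auto
      then have "C * (\<Sum>i\<in>F. qK i f) \<le> \<bar>C\<bar> * (\<Sum>i\<in>F. qK i f)" by (intro mult_right_mono) auto
      also have "\<dots> \<le> \<bar>C\<bar> * (C' * qK i f)" using bspec[OF i(3) that(2)] by (intro mult_left_mono) auto
      finally show ?thesis using bspec[OF bspec[OF C that(1)] that(2)] by (simp add: c_def jm mult.assoc)
    qed
    \<comment> \<open>Each x contributes a disc of multiples of ev m x whose radius c * nu j m x
      absorbs the constant of the bound on H. Unimodular factors preserve the discs, and multiples
      at the full radius nearly dominate y.\<close>
    define D where "D = {(\<lambda>f. a * ev m x f) | a x. x \<in> om m \<and> norm a \<le> c * nu j m x}"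
    have "p \<alpha> (u y) \<le> c * qE (j, m, \<alpha>) (S_map XK u)" if u: "u \<in> ?eps" and y: "y \<in> H" for u y
    proof (rule eps_product_bipolar_bound[OF E u \<alpha>, of _ D])
      show "y \<in> dual" using H y by (auto simp: equicont_def)
      show "D \<subseteq> dual" using wev_dual by (auto simp: D_def)
      show "(\<lambda>f. a * d f) \<in> D" if "d \<in> D" "norm a = 1" for a d
      proof -
        obtain b x where "d = (\<lambda>f. b * ev m x f)" "x \<in> om m" "norm b \<le> c * nu j m x"
          using \<open>d \<in> D\<close> unfolding D_def by (elim CollectE exE conjE) (rule that)
        then show ?thesis unfolding D_def using that(2)
          by (intro CollectI exI[of _ "a * b"] exI[of _ x]) (simp add: norm_mult mult.assoc)
      qed
      show "\<exists>d\<in>D. norm (y f) < norm (d f) + e" if f: "f \<in> XK" and e: "0 < e" for f e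
      proof -
        \<comment> \<open>The supremum over \<open>om m\<close> need not be attained. An error of e
          / (c + 1) there becomes less than e after multiplication by c, also when c = 0.\<close>
        have e': "0 < e / (c + 1)" using e c0 by simp
        obtain x where x: "x \<in> om m" "qK (j, m, ()) f < norm (TK m f x) * nu j m x + e / (c + 1)"
        proof (rule FV_sn_approx[OF vector_space_mult snK weights dataK e', of m j "()" f])
          fix x assume "x \<in> om m"
            "FV_sn (\<lambda>_. norm) TK om nu (j, m, ()) f < norm (TK m f x) * nu j m x + e / (c + 1)"
          then show thesis unfolding qK_def[symmetric] by (rule that)
        qed
        let ?d = "\<lambda>f. of_real (c * nu j m x) * ev m x f"
        have "?d \<in> D" unfolding D_def using x(1) c0 nu0[OF x(1)]
          by (intro CollectI exI[of _ "of_real (c * nu j m x)"] exI[of _ x]) (simp add: norm_mult)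
        moreover have "norm (y f) < norm (?d f) + e"
        proof -
          have "norm (y f) \<le> c * (norm (TK m f x) * nu j m x + e / (c + 1))"
            using y_le[OF y f] mult_left_mono[OF less_imp_le[OF x(2)] c0] by linarith
          also have "\<dots> = norm (?d f) + c * (e / (c + 1))"
            using f c0 nu0[OF x(1)] by (simp add: ev_def norm_mult algebra_simps)
          also have "\<dots> < norm (?d f) + e" using e c0 by (simp add: field_simps)
          finally show ?thesis .
        qed
        ultimately show ?thesis by (intro bexI[of _ ?d])
      qed
      show "p \<alpha> (u d) \<le> c * qE (j, m, \<alpha>) (S_map XK u)" if "d \<in> D" for d
      proof -
        obtain a x where d: "d = (\<lambda>f. a * ev m x f)" "x \<in> om m" "norm a \<le> c * nu j m x"
          using \<open>d \<in> D\<close> unfolding D_def by (elim CollectE exE conjE) (rule that)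
        have "p \<alpha> (u d) = norm a * p \<alpha> (u (ev m x))"
          using u_wev[OF u d(2)] is_seminormD(2)[OF sn[OF \<alpha>]] by (simp add: d(1))
        also have "\<dots> \<le> c * nu j m x * p \<alpha> (u (ev m x))"
          using d(3) is_seminormD(1)[OF sn[OF \<alpha>]] by (rule mult_right_mono)
        also have "\<dots> = c * (p \<alpha> (TE m (S_map XK u) x) * nu j m x)" by (simp add: S(3)[OF u d(2)])
        also have "\<dots> \<le> c * qE (j, m, \<alpha>) (S_map XK u)"
        proof (rule mult_left_mono[OF _ c0])
          show "p \<alpha> (TE m (S_map XK u) x) * nu j m x \<le> qE (j, m, \<alpha>) (S_map XK u)"
            unfolding qE_def
            by (rule FV_sn_upper[where A = A, OF vs _ weights dataE SX[OF u, unfolded XE_def] \<alpha> d(2)])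
              (rule sn)
        qed
        finally show ?thesis .
      qed
    qed
    moreover have "(j, m, \<alpha>) \<in> IE" using \<alpha> by (simp add: IE_def FV_idx_def)
    ultimately show ?thesis using c0 by (intro exI[of _ "(j, m, \<alpha>)"] exI[of _ c]) simp
  qed
  have "inj_on (S_map XK) ?eps"
  proof (rule inj_onI)
    fix u v assume u: "u \<in> ?eps" and v: "v \<in> ?eps" and eq: "S_map XK u = S_map XK v"
    let ?w = "\<lambda>y. u y - v y"
    have w: "?w \<in> ?eps" by (rule eps_product_diff[OF seminormed_fun_space_axioms E u v])
    \<comment> \<open>S records only the values at point evaluations. Consistency turns S w = 0 into
      the vanishing of w at every ev m x, and the bipolar bound extends this to the whole
      dual.\<close>
    have Sw: "S_map XK ?w = (\<lambda>_. 0)" using eq by (simp add: S_map_def fun_eq_iff)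
    have "u y = v y" if y: "y \<in> dual" for y
    proof -
      obtain F C where F: "finite F" "F \<subseteq> IK" "\<And>f. f \<in> XK \<Longrightarrow> norm (y f) \<le> C * (\<Sum>i\<in>F. qK i f)"
        using dual_bound[OF y] by metis
      have eq_y: "equicont XK IK qK {y}"
        unfolding equicont_def using y F by (intro conjI exI[of _ F] exI[of _ C]) auto
      have "p \<alpha> (u y - v y) = 0" if \<alpha>: "\<alpha> \<in> A" for \<alpha>
      proof -
        obtain i C where i: "i \<in> IE" "snd (snd i) = \<alpha>" "p \<alpha> (?w y) \<le> C * qE i (S_map XK ?w)"
        proof -
          from inverse_bound[OF eq_y \<alpha>] obtain i C where i: "i \<in> IE" "snd (snd i) = \<alpha>"
            "\<forall>u\<in>?eps. \<forall>y\<in>{y}. p \<alpha> (u y) \<le> C * qE i (S_map XK u)"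
            by (elim exE conjE) (rule that)
          show thesis by (rule that[OF i(1,2) bspec[OF bspec[OF i(3) w] singletonI]])
        qed
        have "qE i (S_map XK ?w) = 0"
        proof -
          have "i = (fst i, fst (snd i), \<alpha>)" using i(2) by (simp add: prod_eq_iff)
          moreover have "qE (fst i, fst (snd i), \<alpha>) (\<lambda>_. 0) = 0"
            unfolding qE_def by (rule FV_sn_zero[where A = A, OF vs _ weights dataE \<alpha>]) (rule sn)
          ultimately show ?thesis unfolding Sw by simp
        qed
        then show ?thesis using i(3) is_seminormD(1)[OF sn[OF \<alpha>], of "?w y"] by simp
      qed
      moreover have "(\<forall>\<alpha>\<in>A. p \<alpha> (u y - v y) = 0) \<longrightarrow> u y - v y = 0"
        using E unfolding lc_hausdorff_def by (elim conjE allE)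
      ultimately have "u y - v y = 0" by simp
      then show ?thesis by simp
    qed
    moreover have "u y = v y" if "y \<notin> dual" for y using u v that by (simp add: eps_product_def)
    ultimately show "u = v" by (intro ext) metis
  qed
  moreover have "sn_cont ?eps (eps_idx XK IK qK A) (eps_sn p) IE qE (S_map XK)"
    unfolding sn_cont_def
  proof
    fix i assume "i \<in> IE"
    then obtain j m \<alpha> where i: "i = (j, m, \<alpha>)" and \<alpha>: "\<alpha> \<in> A" by (auto simp: IE_def FV_idx_def)
    \<comment> \<open>The weighted evaluations form an equicontinuous set with constant 1, and the
      seminorm of S u equals the epsilon-seminorm of u for this set.\<close>
    define H where "H = (\<lambda>x f. of_real (nu j m x) * ev m x f) ` om m"
    have "norm (y f) \<le> 1 * (\<Sum>i\<in>{(j, m, ())}. qK i f)" if "y \<in> H" "f \<in> XK" for y f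
      using that ev_le[OF _ that(2)] nu0 by (auto simp: H_def norm_mult mult.commute)
    moreover have "H \<subseteq> dual" using wev_dual by (auto simp: H_def)
    ultimately have "equicont XK IK qK H"
      unfolding equicont_def using idx
      by (intro conjI exI[of _ "{(j, m, ())}"] exI[of _ 1] ballI) auto
    moreover have ne: "om m \<noteq> {}" using weights by (simp add: weight_system_def)
    ultimately have idxH: "(H, \<alpha>) \<in> eps_idx XK IK qK A" using \<alpha> by (simp add: eps_idx_def H_def)
    have "qE i (S_map XK u) = eps_sn p (H, \<alpha>) u" if "u \<in> ?eps" for u
      using term_eq[OF that _ \<alpha>] by (simp add: i qE_def FV_sn_def eps_sn_def H_def image_image cong: image_cong)
    then show "\<exists>F C. finite F \<and> F \<subseteq> eps_idx XK IK qK A \<and>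
        (\<forall>u\<in>?eps. qE i (S_map XK u) \<le> C * (\<Sum>i\<in>F. eps_sn p i u))"
      using idxH by (intro exI[of _ "{(H, \<alpha>)}"] exI[of _ 1]) simp
  qed
  moreover have "sn_cont ?eps IE (\<lambda>i u. qE i (S_map XK u)) (eps_idx XK IK qK A) (eps_sn p) id"
    unfolding sn_cont_def
  proof
    fix b assume "b \<in> eps_idx XK IK qK A"
    then obtain H \<alpha> where b: "b = (H, \<alpha>)" "equicont XK IK qK H" "H \<noteq> {}" "\<alpha> \<in> A"
      by (auto simp: eps_idx_def)
    obtain i C where i: "i \<in> IE" "\<And>u y. u \<in> ?eps \<Longrightarrow> y \<in> H \<Longrightarrow> p \<alpha> (u y) \<le> C * qE i (S_map XK u)"
    proof -
      from inverse_bound[OF b(2,4)] obtain i C where i: "i \<in> IE"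
        "\<forall>u\<in>?eps. \<forall>y\<in>H. p \<alpha> (u y) \<le> C * qE i (S_map XK u)"
        by (elim exE conjE) (rule that)
      show thesis by (rule that[OF i(1) bspec[OF bspec[OF i(2)]]])
    qed
    have "eps_sn p b u \<le> C * qE i (S_map XK u)" if "u \<in> ?eps" for u
      unfolding eps_sn_def b(1) using b(3) i(2)[OF that] by (auto intro: cSUP_least)
    then show "\<exists>F C. finite F \<and> F \<subseteq> IE \<and>
        (\<forall>u\<in>?eps. eps_sn p b (id u) \<le> C * (\<Sum>i\<in>F. qE i (S_map XK u)))"
      using i(1) by (intro exI[of _ "{i}"] exI[of _ C]) simp
  qed
  ultimately show ?thesis using SX by (intro conjI ballI)
qed

end
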